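(* Let $\nu\ge0$, $T>0$. For a forcing term $\mathbf f:[0,T]\to L^2(\Omega)^2$, say that $(\mathbf u_h,p_h):[0,T]\to V_h^{1,c}\times V_h^{2,c}$ ($\mathbf u_h$ being $C^1$ in time) solves $(S_{\mathbf f})$ if for all $t$, $$\int_\Omega \frac{\partial \mathbf u_h}{\partial t}\cdot \mathbf v_h+\int_\Omega \mathbf u_h\cdot s_h(\mathbf u_h,\mathbf v_h)+\int_\Omega (\widetilde{\mathrm{grad}}_h\, p_h)\cdot \mathbf v_h+\nu\int_\Omega (\widetilde{\mathrm{curl}}_h\,\mathbf u_h)(\widetilde{\mathrm{curl}}_h\,\mathbf v_h)=\int_\Omega\mathbf f\cdot\mathbf v_h\quad\forall\,\mathbf v_h\in V_h^{1,c},$$ $$\int_\Omega \mathbf u_h\cdot s_h(\mathbf u_h,\widetilde{\mathrm{grad}}_h\, q_h)+\int_\Omega \widetilde{\mathrm{grad}}_h\, p_h\cdot\widetilde{\mathrm{grad}}_h\, q_h=\int_\Omega\mathbf f\cdot\widetilde{\mathrm{grad}}_h\,q_h\quad\forall\, q_h\in V_h^{2,c}.$$ Then the following velocity invariance (pressure-robustness) property holds: for every $\psi:[0,T]\to H^1(\Omega)$ (periodic in the periodic case), replacing $\mathbf f$ by $\mathbf f+\operatorname{grad}\psi$ changes the solution $(\mathbf u_h,p_h)$ into $(\mathbf u_h,p_h+\tilde P_h^0(\psi))$; that is, $(\mathbf u_h,p_h)$ solves $(S_{\mathbf f})$ if and only if $(\mathbf u_h,p_h+\tilde P_h^0(\psi))$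 solves $(S_{\mathbf f+\operatorname{grad}\psi})$, where $\tilde P_h^0$ is the $L^2$-orthogonal projection onto $V_h^{2,c}$.
   Context: Setting (dimension $d=2$). $\Omega$ is a two-dimensional domain with either periodic boundary conditions (a rectangle with opposite sides identified; all function spaces are spaces of periodic functions: $V^0=H^1(\Omega)$, $V^1=H(\mathrm{div};\Omega)$, $V^2=L^2(\Omega)$) or homogeneous boundary conditions on a bounded Lipschitz domain ($V^0=H^1_0(\Omega)$, $V^1=H_0(\mathrm{div};\Omega)$, $V^2=L^2(\Omega)$). For scalar $\omega$, $\operatorname{curl}\omega=(\partial_2\omega,-\partial_1\omega)$. Discrete spaces: $V_h^{\ell,c}\subset V^\ell$, $\ell=0,1,2$, are finite-dimensional (finite element) spaces of bounded functions with $\operatorname{curl}V_h^{0,c}\subset V_h^{1,c}$ and $\operatorname{div}V_h^{1,c}\subset V_h^{2,c}$ (and there are projections $\Pi_\ell:V^\ell\to V_h^{\ell,c}$ with $\operatorname{curl}\Pi_0=\Pi_1\operatorname{curl}$ and $\operatorname{div}\Pi_1=\Pi_2\operatorname{div}$). Discrete dual operators: $\widetilde{\mathrm{grad}}_h:V_h^{2,c}\to V_h^{1,c}$ and $\widetilde{\mathrm{curl}}_h:V_h^{1,c}\to V_h^{0,c}$ are defined by $\int_\Omega \widetilde{\mathrm{grad}}_h q_h\cdot\mathbf v_h=-\int_\Omega q_h\operatorname{div}\mathbf v_h$ and $\int_\Omega(\widetilde{\mathrm{curl}}_h\mathbf v_h)\,\omega_h=\int_\Omega\mathbf v_h\cdot\operatorname{curl}\omega_h$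 for all $q_h\in V_h^{2,c}$, $\mathbf v_h\in V_h^{1,c}$, $\omega_h\in V_h^{0,c}$. Discrete interior product: for a vector $\mathbf a\in\mathbb R^2$, $\tilde\imath^{0h}_{\mathbf a}\mathbf u_h=\tilde P_h^0(\mathbf a\cdot\mathbf u_h)$. With $\mathbf e_1,\mathbf e_2$ the canonical basis and $P_h^1$ the $L^2$-orthogonal projection onto $V_h^{1,c}$, $$s_h(\mathbf u_h,\mathbf v_h)=\tfrac12P_h^1\Big(\sum_{k=1}^{2}(\tilde\imath^{0h}_{\mathbf e_k}\mathbf v_h)\,\widetilde{\mathrm{grad}}_h(\tilde\imath^{0h}_{\mathbf e_k}\mathbf u_h)-(\tilde\imath^{0h}_{\mathbf e_k}\mathbf u_h)\,\widetilde{\mathrm{grad}}_h(\tilde\imath^{0h}_{\mathbf e_k}\mathbf v_h)\Big).$$ *)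

theory Defs
  imports "HOL-Analysis.Analysis"
begin

section \<open>Domains and boundary conditions\<close>

text \<open>
  \<open>Periodic a b\<close> is the rectangle with corners \<open>a\<close>, \<open>b\<close> whose opposite sides are identified;
  \<open>Homogeneous \<Omega>\<close> is a domain \<open>\<Omega>\<close> with homogeneous boundary conditions.
  Only the values of a function on the region (up to null sets) ever matter, so functions on the
  torus are represented by their restrictions to the open rectangle \<open>box a b\<close>; periodicity of the
  Sobolev spaces is enforced by testing against smooth periodic functions.
\<close>

datatype flow_domain = Periodic "real^2" "real^2" | Homogeneous "(real^2) set"

text \<open>A domain that is, near each boundary point and in suitable orthonormal coordinates, the
  epigraph of a Lipschitz function.\<close>

definition lipschitz_domain :: "(real^2) set \<Rightarrow> bool" where
  "lipschitz_domain \<Omega> \<longleftrightarrow> open \<Omega> \<and> connected \<Omega> \<and> \<Omega> \<noteq> {} \<and>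
     (\<forall>z\<in>frontier \<Omega>. \<exists>r>0. \<exists>(R :: real^2 \<Rightarrow> real^2) (\<gamma> :: real \<Rightarrow> real) L.
        orthogonal_transformation R \<and> L-lipschitz_on UNIV \<gamma> \<and>
        \<Omega> \<inter> ball z r = {y \<in> ball z r. R y $ 2 > \<gamma> (R y $ 1)})"

fun region :: "flow_domain \<Rightarrow> (real^2) set" where
  "region (Periodic a b) = box a b"
| "region (Homogeneous \<Omega>) = \<Omega>"

fun admissible :: "flow_domain \<Rightarrow> bool" where
  "admissible (Periodic a b) \<longleftrightarrow> (\<forall>i. a $ i < b $ i)"
| "admissible (Homogeneous \<Omega>) \<longleftrightarrow> bounded \<Omega> \<and> lipschitz_domain \<Omega>"

abbreviation lebS :: "flow_domain \<Rightarrow> (real^2) measure" where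
  "lebS S \<equiv> lebesgue_on (region S)"


section \<open>Test functions\<close>

definition partial :: "2 \<Rightarrow> (real^2 \<Rightarrow> real) \<Rightarrow> real^2 \<Rightarrow> real" where
  "partial i f x = frechet_derivative f (at x) (axis i 1)"

primrec Ck :: "nat \<Rightarrow> (real^2 \<Rightarrow> real) \<Rightarrow> bool" where
  "Ck 0 f \<longleftrightarrow> continuous_on UNIV f"
| "Ck (Suc k) f \<longleftrightarrow> (\<forall>x. f differentiable (at x)) \<and> (\<forall>i. Ck k (partial i f))"

definition smooth :: "(real^2 \<Rightarrow> real) \<Rightarrow> bool" where
  "smooth f \<longleftrightarrow> (\<forall>k. Ck k f)"

definition classical_grad :: "(real^2 \<Rightarrow> real) \<Rightarrow> real^2 \<Rightarrow> real^2" where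
  "classical_grad f x = (\<chi> i. partial i f x)"

definition classical_div :: "(real^2 \<Rightarrow> real^2) \<Rightarrow> real^2 \<Rightarrow> real" where
  "classical_div v x = (\<Sum>i\<in>UNIV. partial i (\<lambda>y. v y $ i) x)"

fun test_functions :: "flow_domain \<Rightarrow> (real^2 \<Rightarrow> real) set" where
  "test_functions (Periodic a b) =
     {\<phi>. smooth \<phi> \<and> (\<forall>x i. \<phi> (x + axis i (b $ i - a $ i)) = \<phi> x)}"
| "test_functions (Homogeneous \<Omega>) =
     {\<phi>. smooth \<phi> \<and> compact (closure {x. \<phi> x \<noteq> 0}) \<and> closure {x. \<phi> x \<noteq> 0} \<subseteq> \<Omega>}"


section \<open>Lebesgue and Sobolev spaces\<close>

definition L2 :: "flow_domain \<Rightarrow> (real^2 \<Rightarrow> 'b::euclidean_space) set" where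
  "L2 S = {f \<in> borel_measurable (lebS S). integrable (lebS S) (\<lambda>x. (norm (f x))\<^sup>2)}"

definition L2_norm :: "flow_domain \<Rightarrow> (real^2 \<Rightarrow> 'b::euclidean_space) \<Rightarrow> real" where
  "L2_norm S f = sqrt (\<integral>x. (norm (f x))\<^sup>2 \<partial>lebS S)"

definition L2_inner ::
    "flow_domain \<Rightarrow> (real^2 \<Rightarrow> 'b::euclidean_space) \<Rightarrow> (real^2 \<Rightarrow> 'b) \<Rightarrow> real" where
  "L2_inner S f g = (\<integral>x. f x \<bullet> g x \<partial>lebS S)"

definition is_weak_grad :: "flow_domain \<Rightarrow> (real^2 \<Rightarrow> real) \<Rightarrow> (real^2 \<Rightarrow> real^2) \<Rightarrow> bool" where
  "is_weak_grad S w g \<longleftrightarrow> g \<in> L2 S \<and>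
     (\<forall>\<phi>\<in>test_functions S. \<forall>i.
        (\<integral>x. w x * partial i \<phi> x \<partial>lebS S) = - (\<integral>x. g x $ i * \<phi> x \<partial>lebS S))"

definition is_weak_div :: "flow_domain \<Rightarrow> (real^2 \<Rightarrow> real^2) \<Rightarrow> (real^2 \<Rightarrow> real) \<Rightarrow> bool" where
  "is_weak_div S v d \<longleftrightarrow> d \<in> L2 S \<and>
     (\<forall>\<phi>\<in>test_functions S.
        (\<integral>x. v x \<bullet> classical_grad \<phi> x \<partial>lebS S) = - (\<integral>x. d x * \<phi> x \<partial>lebS S))"

text \<open>The weak derivatives are unique only up to null sets; the operators below pick a
  representative.\<close>

definition grad :: "flow_domain \<Rightarrow> (real^2 \<Rightarrow> real) \<Rightarrow> real^2 \<Rightarrow> real^2" where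
  "grad S w = (SOME g. is_weak_grad S w g)"

definition wdiv :: "flow_domain \<Rightarrow> (real^2 \<Rightarrow> real^2) \<Rightarrow> real^2 \<Rightarrow> real" where
  "wdiv S v = (SOME d. is_weak_div S v d)"

definition curl :: "flow_domain \<Rightarrow> (real^2 \<Rightarrow> real) \<Rightarrow> real^2 \<Rightarrow> real^2" where
  "curl S w x = vector [grad S w x $ 2, - grad S w x $ 1]"

definition H1 :: "flow_domain \<Rightarrow> (real^2 \<Rightarrow> real) set" where
  "H1 S = {w \<in> L2 S. \<exists>g. is_weak_grad S w g}"

definition Hdiv :: "flow_domain \<Rightarrow> (real^2 \<Rightarrow> real^2) set" where
  "Hdiv S = {v \<in> L2 S. \<exists>d. is_weak_div S v d}"

text \<open>\<open>H1_0\<close> and \<open>Hdiv_0\<close> are the closures of the test functions (test fields) in the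
  graph norms of \<open>H1\<close> and \<open>Hdiv\<close>.\<close>

definition H1_0 :: "flow_domain \<Rightarrow> (real^2 \<Rightarrow> real) set" where
  "H1_0 S = {w \<in> H1 S. \<exists>\<phi>. (\<forall>n::nat. \<phi> n \<in> test_functions S) \<and>
     (\<lambda>n. L2_norm S (\<lambda>x. \<phi> n x - w x)) \<longlonglongrightarrow> 0 \<and>
     (\<lambda>n. L2_norm S (\<lambda>x. classical_grad (\<phi> n) x - grad S w x)) \<longlonglongrightarrow> 0}"

definition Hdiv_0 :: "flow_domain \<Rightarrow> (real^2 \<Rightarrow> real^2) set" where
  "Hdiv_0 S = {v \<in> Hdiv S. \<exists>\<phi>. (\<forall>n::nat. \<forall>i. (\<lambda>x. \<phi> n x $ i) \<in> test_functions S) \<and>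
     (\<lambda>n. L2_norm S (\<lambda>x. \<phi> n x - v x)) \<longlonglongrightarrow> 0 \<and>
     (\<lambda>n. L2_norm S (\<lambda>x. classical_div (\<phi> n) x - wdiv S v x)) \<longlonglongrightarrow> 0}"

fun V0 :: "flow_domain \<Rightarrow> (real^2 \<Rightarrow> real) set" where
  "V0 (Periodic a b) = H1 (Periodic a b)"
| "V0 (Homogeneous \<Omega>) = H1_0 (Homogeneous \<Omega>)"

fun V1 :: "flow_domain \<Rightarrow> (real^2 \<Rightarrow> real^2) set" where
  "V1 (Periodic a b) = Hdiv (Periodic a b)"
| "V1 (Homogeneous \<Omega>) = Hdiv_0 (Homogeneous \<Omega>)"

definition V2 :: "flow_domain \<Rightarrow> (real^2 \<Rightarrow> real) set" where
  "V2 S = L2 S"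


section \<open>Discrete spaces\<close>

text \<open>A finite-dimensional space \<open>Vh\<close> of bounded elements of \<open>V\<close>. Elements of \<open>L2\<close> are classes of
  functions modulo null sets, so \<open>Vh\<close> is a set of functions saturated under equality almost
  everywhere, and its dimension is finite modulo such equality.\<close>

definition fe_space ::
    "flow_domain \<Rightarrow> (real^2 \<Rightarrow> 'b::euclidean_space) set \<Rightarrow> (real^2 \<Rightarrow> 'b) set \<Rightarrow> bool" where
  "fe_space S V Vh \<longleftrightarrow> Vh \<subseteq> V \<and>
     (\<lambda>x. 0) \<in> Vh \<and>
     (\<forall>f\<in>Vh. \<forall>g\<in>Vh. (\<lambda>x. f x + g x) \<in> Vh) \<and>
     (\<forall>c. \<forall>f\<in>Vh. (\<lambda>x. c *\<^sub>R f x) \<in> Vh) \<and>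
     (\<forall>f\<in>Vh. \<forall>g. (AE x in lebS S. g x = f x) \<longrightarrow> g \<in> Vh) \<and>
     (\<exists>B. finite B \<and> B \<subseteq> Vh \<and>
        (\<forall>f\<in>Vh. \<exists>c. AE x in lebS S. f x = (\<Sum>b\<in>B. c b *\<^sub>R b x))) \<and>
     (\<forall>f\<in>Vh. \<exists>M. AE x in lebS S. norm (f x) \<le> M)"

definition projection_onto ::
    "flow_domain \<Rightarrow> (real^2 \<Rightarrow> 'b::euclidean_space) set \<Rightarrow> (real^2 \<Rightarrow> 'b) set
      \<Rightarrow> ((real^2 \<Rightarrow> 'b) \<Rightarrow> (real^2 \<Rightarrow> 'b)) \<Rightarrow> bool" where
  "projection_onto S V Vh P \<longleftrightarrow>
     (\<forall>v\<in>V. P v \<in> Vh) \<and>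
     (\<forall>v\<in>Vh. AE x in lebS S. P v x = v x) \<and>
     (\<forall>u\<in>V. \<forall>v\<in>V. (AE x in lebS S. u x = v x) \<longrightarrow> (AE x in lebS S. P u x = P v x)) \<and>
     (\<forall>u\<in>V. \<forall>v\<in>V. AE x in lebS S. P (\<lambda>y. u y + v y) x = P u x + P v x) \<and>
     (\<forall>c. \<forall>v\<in>V. AE x in lebS S. P (\<lambda>y. c *\<^sub>R v y) x = c *\<^sub>R P v x)"

definition discrete_complex ::
    "flow_domain \<Rightarrow> (real^2 \<Rightarrow> real) set \<Rightarrow> (real^2 \<Rightarrow> real^2) set \<Rightarrow> (real^2 \<Rightarrow> real) set \<Rightarrow> bool"
  where
  "discrete_complex S V0h V1h V2h \<longleftrightarrow>
     fe_space S (V0 S) V0h \<and> fe_space S (V1 S) V1h \<and> fe_space S (V2 S) V2h \<and>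
     curl S ` V0h \<subseteq> V1h \<and> wdiv S ` V1h \<subseteq> V2h \<and>
     (\<exists>P0 P1 P2. projection_onto S (V0 S) V0h P0 \<and>
        projection_onto S (V1 S) V1h P1 \<and> projection_onto S (V2 S) V2h P2 \<and>
        (\<forall>w\<in>V0 S. AE x in lebS S. curl S (P0 w) x = P1 (curl S w) x) \<and>
        (\<forall>v\<in>V1 S. AE x in lebS S. wdiv S (P1 v) x = P2 (wdiv S v) x))"


section \<open>Discrete operators\<close>

text \<open>In each case the defining property determines the chosen element up to null sets.\<close>

definition L2_proj ::
    "flow_domain \<Rightarrow> (real^2 \<Rightarrow> 'b::euclidean_space) set \<Rightarrow> (real^2 \<Rightarrow> 'b) \<Rightarrow> real^2 \<Rightarrow> 'b" where
  "L2_proj S Vh f = (SOME g. g \<in> Vh \<and> (\<forall>h\<in>Vh. L2_inner S g h = L2_inner S f h))"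

definition dual_grad ::
    "flow_domain \<Rightarrow> (real^2 \<Rightarrow> real^2) set \<Rightarrow> (real^2 \<Rightarrow> real) \<Rightarrow> real^2 \<Rightarrow> real^2" where
  "dual_grad S V1h q =
     (SOME g. g \<in> V1h \<and> (\<forall>v\<in>V1h. L2_inner S g v = - L2_inner S q (wdiv S v)))"

definition dual_curl ::
    "flow_domain \<Rightarrow> (real^2 \<Rightarrow> real) set \<Rightarrow> (real^2 \<Rightarrow> real^2) \<Rightarrow> real^2 \<Rightarrow> real" where
  "dual_curl S V0h v =
     (SOME w. w \<in> V0h \<and> (\<forall>\<omega>\<in>V0h. L2_inner S w \<omega> = L2_inner S v (curl S \<omega>)))"

definition interior_prod ::
    "flow_domain \<Rightarrow> (real^2 \<Rightarrow> real) set \<Rightarrow> real^2 \<Rightarrow> (real^2 \<Rightarrow> real^2) \<Rightarrow> real^2 \<Rightarrow> real" where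
  "interior_prod S V2h a u = L2_proj S V2h (\<lambda>x. a \<bullet> u x)"

definition s_h ::
    "flow_domain \<Rightarrow> (real^2 \<Rightarrow> real^2) set \<Rightarrow> (real^2 \<Rightarrow> real) set
      \<Rightarrow> (real^2 \<Rightarrow> real^2) \<Rightarrow> (real^2 \<Rightarrow> real^2) \<Rightarrow> real^2 \<Rightarrow> real^2" where
  "s_h S V1h V2h u v = (\<lambda>x. (1 / 2) *\<^sub>R L2_proj S V1h
     (\<lambda>y. \<Sum>k\<in>UNIV.
        interior_prod S V2h (axis k 1) v y *\<^sub>R
          dual_grad S V1h (interior_prod S V2h (axis k 1) u) y
        - interior_prod S V2h (axis k 1) u y *\<^sub>R
          dual_grad S V1h (interior_prod S V2h (axis k 1) v) y) x)"


section \<open>The semi-discrete problem\<close>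

text \<open>\<open>u'\<close> is the continuous time derivative of \<open>u\<close> on \<open>[0,T]\<close> (one-sided at the end points),
  with respect to the \<open>L2\<close> norm; on a finite-dimensional space all norms are equivalent.\<close>

definition C1_in_time ::
    "flow_domain \<Rightarrow> real \<Rightarrow> (real \<Rightarrow> real^2 \<Rightarrow> real^2) \<Rightarrow> (real \<Rightarrow> real^2 \<Rightarrow> real^2) \<Rightarrow> bool" where
  "C1_in_time S T u u' \<longleftrightarrow>
     (\<forall>t\<in>{0..T}.
        ((\<lambda>s. L2_norm S (\<lambda>x. (u s x - u t x) /\<^sub>R (s - t) - u' t x)) \<longlongrightarrow> 0) (at t within {0..T}) \<and>
        ((\<lambda>s. L2_norm S (\<lambda>x. u' s x - u' t x)) \<longlongrightarrow> 0) (at t within {0..T}))"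

definition solves ::
    "flow_domain \<Rightarrow> (real^2 \<Rightarrow> real) set \<Rightarrow> (real^2 \<Rightarrow> real^2) set \<Rightarrow> (real^2 \<Rightarrow> real) set
      \<Rightarrow> real \<Rightarrow> real \<Rightarrow> (real \<Rightarrow> real^2 \<Rightarrow> real^2)
      \<Rightarrow> (real \<Rightarrow> real^2 \<Rightarrow> real^2) \<Rightarrow> (real \<Rightarrow> real^2 \<Rightarrow> real) \<Rightarrow> bool" where
  "solves S V0h V1h V2h \<nu> T f u p \<longleftrightarrow>
     (\<forall>t\<in>{0..T}. u t \<in> V1h \<and> p t \<in> V2h) \<and>
     (\<exists>u'. (\<forall>t\<in>{0..T}. u' t \<in> V1h) \<and> C1_in_time S T u u' \<and>
        (\<forall>t\<in>{0..T}.
          (\<forall>v\<in>V1h.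
             L2_inner S (u' t) v + L2_inner S (u t) (s_h S V1h V2h (u t) v)
               + L2_inner S (dual_grad S V1h (p t)) v
               + \<nu> * L2_inner S (dual_curl S V0h (u t)) (dual_curl S V0h v)
             = L2_inner S (f t) v) \<and>
          (\<forall>q\<in>V2h.
             L2_inner S (u t) (s_h S V1h V2h (u t) (dual_grad S V1h q))
               + L2_inner S (dual_grad S V1h (p t)) (dual_grad S V1h q)
             = L2_inner S (f t) (dual_grad S V1h q))))"

end

theory Submission
  imports Defs
begin

text \<open>
  The theorem rests on \<open>(grad \<psi>, v) = - (\<psi>, div v)\<close> for discrete velocities \<open>v\<close>: the right-hand
  side is \<open>- (P \<psi>, div v)\<close>, which is \<open>(grad_h (P \<psi>), v)\<close> for the discrete gradient \<open>grad_h\<close>, so the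
  two sides of each equation change by the same amount.
  With homogeneous boundary conditions the identity is the limit of the definition of the weak
  gradient along test fields approximating \<open>v\<close>. In the periodic case \<open>\<psi>\<close> is projected onto finitely
  many Fourier modes; this projection commutes with differentiation and produces test functions for
  the weak divergence of \<open>v\<close>. As \<open>v\<close> and \<open>div v\<close> are bounded, trigonometric polynomials approximate
  them in \<open>L2\<close>, which suffices to pass to the limit.
\<close>

section \<open>Inner products and finite-dimensional subspaces of L2\<close>

text \<open>\<open>L2_proj\<close>, \<open>dual_grad\<close>, \<open>grad\<close> and
  \<open>wdiv\<close> are choices (\<open>SOME\<close>) and say nothing until a witness exists. For
  the discrete operators used here the witness comes from a Riesz representation in a
  finite-dimensional space modulo null sets, whose functional must be linear and vanish on null
  functions. For \<open>dual_grad\<close> this is delicate: the functional involves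
  \<open>wdiv\<close>, which respects sums only up to null sets, and even that rests on uniqueness
  of weak divergences. On the torus the weak gradient of \<psi> and the weak divergence of v are
  both tested only against smooth functions, so neither definition applies directly to the other
  function. Since \<psi> is projected, norm bounds on the projections are enough: convergence is
  asked only of the approximations of v and its divergence. Boundedness of these two reduces their
  approximation to uniform approximation and dominated convergence. The pressure equation is tested
  with a discrete gradient, itself a discrete velocity, so one identity serves both
  equations.\<close>

lemma admissible_region:
  assumes "admissible S"
  shows open_region: "open (region S)" and bounded_region: "bounded (region S)"
    and lmeasurable_region: "region S \<in> lmeasurable"
proof -
  show o: "open (region S)"
    using assms by (cases S) (auto simp: lipschitz_domain_def)
  show b: "bounded (region S)"
    using assms by (cases S) (auto)
  show "region S \<in> lmeasurable"
    using o b by (simp add: lmeasurable_open)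
qed

lemma finite_measure_lebS:
  assumes "admissible S"
  shows "finite_measure (lebS S)"
  using finite_measure_lebesgue_on lmeasurable_region[OF assms] by blast

lemma L2_measurable: "f \<in> L2 S \<Longrightarrow> f \<in> borel_measurable (lebS S)"
  by (simp add: L2_def)

lemma L2_dot_integrable:
  assumes "f \<in> L2 S" "g \<in> L2 S"
  shows "integrable (lebS S) (\<lambda>x. f x \<bullet> g x)"
proof (rule Bochner_Integration.integrable_bound)
  show "integrable (lebS S) (\<lambda>x. (norm (f x))\<^sup>2 + (norm (g x))\<^sup>2)"
    using assms by (auto simp: L2_def)
  show "(\<lambda>x. f x \<bullet> g x) \<in> borel_measurable (lebS S)"
    using assms by (auto simp: L2_def)
  have "norm (f x \<bullet> g x) \<le> norm ((norm (f x))\<^sup>2 + (norm (g x))\<^sup>2)" for x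
  proof -
    have "\<bar>f x \<bullet> g x\<bar> \<le> norm (f x) * norm (g x)" by (rule Cauchy_Schwarz_ineq2)
    moreover have "2 * (norm (f x) * norm (g x)) \<le> (norm (f x))\<^sup>2 + (norm (g x))\<^sup>2"
      using sum_squares_bound[of "norm (f x)" "norm (g x)"] by simp
    moreover have "0 \<le> norm (f x) * norm (g x)" by simp
    ultimately show ?thesis by simp
  qed
  then show "AE x in lebS S. norm (f x \<bullet> g x) \<le> norm ((norm (f x))\<^sup>2 + (norm (g x))\<^sup>2)"
    by simp
qed

lemma L2_scale:
  assumes "f \<in> L2 S" shows "(\<lambda>x. c *\<^sub>R f x) \<in> L2 S"
  using assms by (auto simp: L2_def power_mult_distrib)

lemma L2_add:
  assumes "f \<in> L2 S" "g \<in> L2 S" shows "(\<lambda>x. f x + g x) \<in> L2 S"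
proof -
  have "(norm (f x + g x))\<^sup>2 = (norm (f x))\<^sup>2 + 2 * (f x \<bullet> g x) + (norm (g x))\<^sup>2" for x
    by (simp add: power2_norm_eq_inner inner_add_left inner_add_right inner_commute)
  then show ?thesis
    using assms L2_dot_integrable[OF assms] by (auto simp: L2_def)
qed

lemma L2_diff:
  assumes "f \<in> L2 S" "g \<in> L2 S" shows "(\<lambda>x. f x - g x) \<in> L2 S"
  using L2_add[OF assms(1) L2_scale[OF assms(2), of "-1"]] by simp

lemma L2_zero: "(\<lambda>x. 0) \<in> L2 S"
  by (auto simp: L2_def)

lemma L2_component:
  fixes f :: "real^2 \<Rightarrow> real^2"
  assumes "f \<in> L2 S" shows "(\<lambda>x. f x $ i) \<in> L2 S"
proof -
  have m: "(\<lambda>x. f x $ i) \<in> borel_measurable (lebS S)"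
    using borel_measurable_inner[OF L2_measurable[OF assms] borel_measurable_const[of "axis i 1"]]
    by (simp add: inner_axis)
  have "integrable (lebS S) (\<lambda>x. (norm (f x $ i))\<^sup>2)"
  proof (rule Bochner_Integration.integrable_bound)
    show "integrable (lebS S) (\<lambda>x. (norm (f x))\<^sup>2)" using assms by (auto simp: L2_def)
    show "(\<lambda>x. (norm (f x $ i))\<^sup>2) \<in> borel_measurable (lebS S)" using m by simp
    show "AE x in lebS S. norm ((norm (f x $ i))\<^sup>2) \<le> norm ((norm (f x))\<^sup>2)"
      using power_mono[OF component_le_norm_cart[of _ i] abs_ge_zero, of _ 2] by auto
  qed
  with m show ?thesis by (simp add: L2_def)
qed

lemma L2_bounded:
  assumes "admissible S" "f \<in> borel_measurable (lebS S)" "AE x in lebS S. norm (f x) \<le> K"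
  shows "f \<in> L2 S"
proof -
  interpret finite_measure "lebS S" by (rule finite_measure_lebS[OF assms(1)])
  have "integrable (lebS S) (\<lambda>x. (norm (f x))\<^sup>2)"
    by (rule integrable_const_bound[where B="K\<^sup>2"])
      (use assms(2) in \<open>auto intro!: eventually_mono[OF assms(3)] power_mono\<close>)
  with assms(2) show ?thesis by (simp add: L2_def)
qed

text \<open>Continuity on the whole plane gives a bound on the compact closure of the
  region.\<close>

lemma L2_continuous:
  fixes f :: "real^2 \<Rightarrow> 'b::euclidean_space"
  assumes "admissible S" "continuous_on UNIV f"
  shows "f \<in> L2 S"
proof -
  have "compact (f ` closure (region S))"
    using bounded_region[OF assms(1)]
    by (intro compact_continuous_image continuous_on_subset[OF assms(2)]) auto
  then obtain K where K: "\<And>x. x \<in> closure (region S) \<Longrightarrow> norm (f x) \<le> K"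
    by (meson bounded_iff compact_imp_bounded imageI)
  show ?thesis
  proof (rule L2_bounded[OF assms(1)])
    show "f \<in> borel_measurable (lebS S)"
      using lmeasurable_region[OF assms(1)]
      by (intro continuous_imp_measurable_on_sets_lebesgue continuous_on_subset[OF assms(2)]) auto
    show "AE x in lebS S. norm (f x) \<le> K"
      using K closure_subset by (intro AE_I2) auto
  qed
qed

lemma L2_inner_commute: "L2_inner S f g = L2_inner S g f"
  by (simp add: L2_inner_def inner_commute)

lemma L2_inner_add_left:
  assumes "f \<in> L2 S" "g \<in> L2 S" "h \<in> L2 S"
  shows "L2_inner S (\<lambda>x. f x + g x) h = L2_inner S f h + L2_inner S g h"
  using assms by (simp add: L2_inner_def inner_add_left L2_dot_integrable)

lemma L2_inner_add_right:
  assumes "f \<in> L2 S" "g \<in> L2 S" "h \<in> L2 S"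
  shows "L2_inner S h (\<lambda>x. f x + g x) = L2_inner S h f + L2_inner S h g"
  using assms by (simp add: L2_inner_def inner_add_right L2_dot_integrable)

lemma L2_inner_diff_left:
  assumes "f \<in> L2 S" "g \<in> L2 S" "h \<in> L2 S"
  shows "L2_inner S (\<lambda>x. f x - g x) h = L2_inner S f h - L2_inner S g h"
  using assms by (simp add: L2_inner_def inner_diff_left L2_dot_integrable)

lemma L2_inner_diff_right:
  assumes "f \<in> L2 S" "g \<in> L2 S" "h \<in> L2 S"
  shows "L2_inner S h (\<lambda>x. f x - g x) = L2_inner S h f - L2_inner S h g"
  using assms by (simp add: L2_inner_def inner_diff_right L2_dot_integrable)

lemma L2_inner_scale_left: "L2_inner S (\<lambda>x. c *\<^sub>R f x) g = c * L2_inner S f g"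
  by (simp add: L2_inner_def)

lemma L2_inner_scale_right: "L2_inner S f (\<lambda>x. c *\<^sub>R g x) = c * L2_inner S f g"
  by (simp add: L2_inner_def)

lemma L2_norm_power2: "(L2_norm S f)\<^sup>2 = L2_inner S f f"
  by (simp add: L2_norm_def L2_inner_def power2_norm_eq_inner)

lemma L2_norm_nonneg: "0 \<le> L2_norm S f"
  by (simp add: L2_norm_def)

lemma L2_inner_self_nonneg: "0 \<le> L2_inner S f f"
  by (simp flip: L2_norm_power2)

lemma L2_inner_self_eq_0:
  assumes "f \<in> L2 S" "L2_inner S f f = 0"
  shows "AE x in lebS S. f x = 0"
proof -
  have "AE x in lebS S. f x \<bullet> f x = 0"
    using integral_nonneg_eq_0_iff_AE[OF L2_dot_integrable[OF assms(1) assms(1)]] assms(2)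
    by (simp add: L2_inner_def)
  then show ?thesis by simp
qed

lemma L2_inner_cong_AE_right:
  assumes "g \<in> L2 S" "h \<in> L2 S" "f \<in> L2 S" "AE x in lebS S. g x = h x"
  shows "L2_inner S f g = L2_inner S f h"
  unfolding L2_inner_def
  using assms L2_dot_integrable[of f S]
  by (intro integral_cong_AE) (auto intro: borel_measurable_integrable)

text \<open>Expanding the squared norm of f + t g gives a quadratic in t that is nowhere negative;
  its discriminant yields Cauchy-Schwarz. The form is only semidefinite on functions, so the case
  where g has norm zero is treated apart.\<close>

lemma L2_inner_le_norm:
  assumes "f \<in> L2 S" "g \<in> L2 S"
  shows "\<bar>L2_inner S f g\<bar> \<le> L2_norm S f * L2_norm S g"
proof -
  let ?A = "L2_inner S f f" and ?B = "L2_inner S f g" and ?C = "L2_inner S g g"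
  have q: "0 \<le> ?A + 2 * t * ?B + t\<^sup>2 * ?C" for t
  proof -
    have tg: "(\<lambda>x. t *\<^sub>R g x) \<in> L2 S" by (rule L2_scale[OF assms(2)])
    have "0 \<le> L2_inner S (\<lambda>x. f x + t *\<^sub>R g x) (\<lambda>x. f x + t *\<^sub>R g x)"
      by (rule L2_inner_self_nonneg)
    also have "\<dots> = ?A + 2 * t * ?B + t\<^sup>2 * ?C"
      by (simp add: L2_inner_add_left L2_inner_add_right assms tg L2_add L2_inner_scale_left
          L2_inner_scale_right L2_inner_commute[of S g f] power2_eq_square algebra_simps)
    finally show ?thesis .
  qed
  have "?B\<^sup>2 \<le> ?A * ?C"
  proof (cases "?C = 0")
    case True
    have "?B = 0"
    proof (rule ccontr)
      assume "?B \<noteq> 0"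
      \<comment> \<open>This t turns the affine expression \<open>?A + 2 * t * ?B\<close> into
        -1.\<close>
      with q[of "- (?A + 1) / (2 * ?B)"] True show False by (simp add: field_simps)
    qed
    with True show ?thesis by simp
  next
    case False
    then have C: "?C > 0" using L2_inner_self_nonneg[of S g] by simp
    \<comment> \<open>The quadratic is evaluated at its minimiser.\<close>
    have "0 \<le> ?A + 2 * (- ?B / ?C) * ?B + (- ?B / ?C)\<^sup>2 * ?C" by (rule q)
    also have "\<dots> = ?A - ?B\<^sup>2 / ?C"
      using C by (simp add: field_simps power2_eq_square)
    finally show ?thesis using C by (simp add: field_simps)
  qed
  then have "?B\<^sup>2 \<le> (L2_norm S f * L2_norm S g)\<^sup>2"
    by (simp add: power_mult_distrib L2_norm_power2)
  then show ?thesis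
    by (metis L2_norm_nonneg abs_le_square_iff abs_of_nonneg mult_nonneg_nonneg)
qed

lemma L2_norm_triangle:
  assumes "f \<in> L2 S" "g \<in> L2 S"
  shows "L2_norm S (\<lambda>x. f x + g x) \<le> L2_norm S f + L2_norm S g"
proof -
  have "(L2_norm S (\<lambda>x. f x + g x))\<^sup>2 = (L2_norm S f)\<^sup>2 + 2 * L2_inner S f g + (L2_norm S g)\<^sup>2"
    by (simp add: L2_norm_power2 L2_inner_add_left L2_inner_add_right assms L2_add
        L2_inner_commute[of S g f])
  also have "\<dots> \<le> (L2_norm S f + L2_norm S g)\<^sup>2"
    using L2_inner_le_norm[OF assms] by (simp add: power2_sum)
  finally show ?thesis
    using L2_norm_nonneg by (meson add_nonneg_nonneg power2_le_imp_le)
qed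

lemma L2_norm_scale: "L2_norm S (\<lambda>x. c *\<^sub>R f x) = \<bar>c\<bar> * L2_norm S f"
  by (simp add: L2_norm_def power_mult_distrib real_sqrt_mult)

lemma tendsto_L2_inner:
  assumes "\<And>n. f n \<in> L2 S" "g \<in> L2 S" "h \<in> L2 S"
    and "(\<lambda>n. L2_norm S (\<lambda>x. f n x - g x)) \<longlonglongrightarrow> 0"
  shows "(\<lambda>n. L2_inner S h (f n)) \<longlonglongrightarrow> L2_inner S h g"
proof -
  have "(\<lambda>n. L2_inner S h (f n) - L2_inner S h g) \<longlonglongrightarrow> 0"
  proof (rule Lim_null_comparison)
    show "(\<lambda>n. L2_norm S h * L2_norm S (\<lambda>x. f n x - g x)) \<longlonglongrightarrow> 0"
      using tendsto_mult_left[OF assms(4), of "L2_norm S h"] by simp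
    show "\<forall>\<^sub>F n in sequentially. norm (L2_inner S h (f n) - L2_inner S h g)
        \<le> L2_norm S h * L2_norm S (\<lambda>x. f n x - g x)"
      using L2_inner_le_norm[OF assms(3) L2_diff[OF assms(1,2)]] assms
      by (simp add: L2_inner_diff_right)
  qed
  then show ?thesis by (simp add: LIM_zero_iff)
qed

section \<open>Riesz representation in finite-dimensional function spaces\<close>

definition fun_subspace :: "(real^2 \<Rightarrow> 'b::euclidean_space) set \<Rightarrow> bool" where
  "fun_subspace V \<longleftrightarrow> (\<lambda>x. 0) \<in> V \<and> (\<forall>f\<in>V. \<forall>g\<in>V. (\<lambda>x. f x + g x) \<in> V) \<and>
     (\<forall>c. \<forall>f\<in>V. (\<lambda>x. c *\<^sub>R f x) \<in> V)"

definition linear_functional_on ::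
    "(real^2 \<Rightarrow> 'b::euclidean_space) set \<Rightarrow> ((real^2 \<Rightarrow> 'b) \<Rightarrow> real) \<Rightarrow> bool" where
  "linear_functional_on V l \<longleftrightarrow> (\<forall>f\<in>V. \<forall>g\<in>V. l (\<lambda>x. f x + g x) = l f + l g) \<and>
     (\<forall>c. \<forall>f\<in>V. l (\<lambda>x. c *\<^sub>R f x) = c * l f)"

lemma fun_subspaceD:
  assumes "fun_subspace V"
  shows "(\<lambda>x. 0) \<in> V" "\<lbrakk>f \<in> V; g \<in> V\<rbrakk> \<Longrightarrow> (\<lambda>x. f x + g x) \<in> V"
    "f \<in> V \<Longrightarrow> (\<lambda>x. c *\<^sub>R f x) \<in> V"
  using assms by (auto simp: fun_subspace_def)

lemma linear_functional_onD:
  assumes "linear_functional_on V l"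
  shows "\<lbrakk>f \<in> V; g \<in> V\<rbrakk> \<Longrightarrow> l (\<lambda>x. f x + g x) = l f + l g"
    "f \<in> V \<Longrightarrow> l (\<lambda>x. c *\<^sub>R f x) = c * l f"
  using assms by (auto simp: linear_functional_on_def)

lemma linear_functional_L2_inner:
  assumes "V \<subseteq> L2 S" "g \<in> L2 S"
  shows "linear_functional_on V (L2_inner S g)"
  using assms by (auto simp: linear_functional_on_def L2_inner_add_right L2_inner_scale_right subset_iff)

lemma linear_functional_sum:
  assumes V: "fun_subspace V" and l: "linear_functional_on V l"
    and "finite B" "B \<subseteq> V"
  shows "(\<lambda>x. \<Sum>b\<in>B. c b *\<^sub>R b x) \<in> V \<and> l (\<lambda>x. \<Sum>b\<in>B. c b *\<^sub>R b x) = (\<Sum>b\<in>B. c b * l b)"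
  using \<open>finite B\<close> \<open>B \<subseteq> V\<close>
proof (induction B)
  case empty
  then show ?case
    using fun_subspaceD(1)[OF V] linear_functional_onD(2)[OF l fun_subspaceD(1)[OF V], of 0] by simp
next
  case (insert b B)
  then have b: "b \<in> V" and s: "(\<lambda>x. \<Sum>b\<in>B. c b *\<^sub>R b x) \<in> V"
    and ls: "l (\<lambda>x. \<Sum>b\<in>B. c b *\<^sub>R b x) = (\<Sum>b\<in>B. c b * l b)" by auto
  have cb: "(\<lambda>x. c b *\<^sub>R b x) \<in> V" by (rule fun_subspaceD(3)[OF V b])
  show ?case
    using insert.hyps fun_subspaceD(2)[OF V cb s] linear_functional_onD(1)[OF l cb s]
      linear_functional_onD(2)[OF l b, of "c b"] ls by simp
qed

text \<open>Gram-Schmidt by induction on an arbitrary finite \<open>B\<close>. The induction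
  hypothesis is used for two functionals, hence the generalisation over \<open>l\<close>: for
  \<open>l\<close> itself it gives g, and for the inner product with \<open>b0\<close> it gives the
  orthogonal projection p of \<open>b0\<close> onto the span of \<open>B\<close>. The residual of
  \<open>b0\<close> is orthogonal to \<open>B\<close>, so adding a multiple of it to g corrects the
  value at \<open>b0\<close> without disturbing the others. That the representing function is a
  combination of \<open>B\<close> is part of the claim because it makes the residual orthogonal to g
  and p as well.\<close>

lemma riesz_on_basis:
  assumes VL2: "V \<subseteq> L2 S" and V: "fun_subspace V"
    and "finite B" "B \<subseteq> V"
    and "linear_functional_on V l"
    and "\<And>f. f \<in> V \<Longrightarrow> AE x in lebS S. f x = 0 \<Longrightarrow> l f = 0"
  shows "\<exists>g. g \<in> V \<and> (\<exists>d. g = (\<lambda>x. \<Sum>b\<in>B. d b *\<^sub>R b x)) \<and> (\<forall>b\<in>B. L2_inner S g b = l b)"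
  using \<open>finite B\<close> \<open>B \<subseteq> V\<close> assms(5,6)
proof (induction B arbitrary: l)
  case empty
  then show ?case using fun_subspaceD(1)[OF V] by auto
next
  case (insert b0 B)
  note L2 = VL2[THEN subsetD]
  note l = linear_functional_onD[OF insert.prems(2)]
  note inner_sum = linear_functional_sum[OF V linear_functional_L2_inner[OF VL2 L2] insert.hyps(1)]
  have b0: "b0 \<in> V" and BV: "B \<subseteq> V" using insert.prems by auto
  obtain g d where g: "g \<in> V" "\<And>b. b \<in> B \<Longrightarrow> L2_inner S g b = l b"
    and d: "g = (\<lambda>x. \<Sum>b\<in>B. d b *\<^sub>R b x)"
    using insert.IH[OF BV insert.prems(2)] insert.prems(3) by blast
  have "L2_inner S b0 f = 0" if f: "f \<in> V" "AE x in lebS S. f x = 0" for f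
    using L2_inner_cong_AE_right[OF L2[OF f(1)] L2_zero L2[OF b0]] f(2) by (simp add: L2_inner_def)
  then obtain p c where p: "p \<in> V" "\<And>b. b \<in> B \<Longrightarrow> L2_inner S p b = L2_inner S b0 b"
    and c: "p = (\<lambda>x. \<Sum>b\<in>B. c b *\<^sub>R b x)"
    using insert.IH[OF BV linear_functional_L2_inner[OF VL2 L2[OF b0]]] by blast
  define r where "r = (\<lambda>x. b0 x + (-1) *\<^sub>R p x)"
  have rV: "r \<in> V" unfolding r_def by (intro fun_subspaceD[OF V] b0 p)
  have r_orth: "L2_inner S r b = 0" if "b \<in> B" for b
  proof -
    have "L2_inner S (\<lambda>x. b0 x - p x) b = 0"
      using p(2)[OF that] that BV by (simp add: L2_inner_diff_left L2 b0 p(1) subset_iff)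
    then show ?thesis by (simp add: r_def)
  qed
  have l_p: "l p = (\<Sum>b\<in>B. c b * l b)"
    unfolding c using linear_functional_sum[OF V insert.prems(2) insert.hyps(1) BV] by blast
  have inner_p: "L2_inner S h p = (\<Sum>b\<in>B. c b * L2_inner S h b)" if "h \<in> V" for h
    unfolding c using inner_sum[OF that BV] by blast
  have b0_eq: "b0 = (\<lambda>x. r x + p x)" by (simp add: r_def)
  have l_b0: "l b0 = l r + l p" by (subst b0_eq) (rule l(1)[OF rV p(1)])
  have inner_b0: "L2_inner S h b0 = L2_inner S h r + L2_inner S h p" if "h \<in> V" for h
    by (subst b0_eq) (simp add: L2_inner_add_right L2 rV p that)
  have gp: "L2_inner S g p = l p" by (simp add: inner_p g l_p)
  have rp: "L2_inner S r p = 0" by (simp add: inner_p rV r_orth)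
  have "L2_inner S r g = (\<Sum>b\<in>B. d b * L2_inner S r b)"
    unfolding d using inner_sum[OF rV BV] by blast
  then have "L2_inner S r g = 0" by (simp add: r_orth)
  then have gr: "L2_inner S g r = 0" by (simp only: L2_inner_commute[of S g])
  \<comment> \<open>If r has norm zero, division by zero yields a = 0; the equation below still
    holds, since r is then null and \<open>l\<close> vanishes on null functions.\<close>
  define a where "a = l r / L2_inner S r r"
  have a: "a * L2_inner S r r = l r"
  proof (cases "L2_inner S r r = 0")
    case True
    then have "l r = 0" using insert.prems(3)[OF rV L2_inner_self_eq_0[OF L2[OF rV]]] by simp
    then show ?thesis by (simp add: a_def)
  qed (simp add: a_def)
  define G where "G = (\<lambda>x. g x + a *\<^sub>R r x)"
  have GV: "G \<in> V" unfolding G_def by (intro fun_subspaceD[OF V] g rV)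
  have inner_G: "L2_inner S G h = L2_inner S g h + a * L2_inner S r h" if "h \<in> V" for h
    unfolding G_def by (simp add: L2_inner_add_left L2_inner_scale_left L2 g rV that L2_scale)
  have "L2_inner S G b0 = l b0"
    by (simp add: inner_G b0 inner_b0 g(1) rV gr gp rp l_b0 a)
  moreover have "L2_inner S G b = l b" if "b \<in> B" for b
    using that BV by (simp add: inner_G g r_orth subset_iff)
  moreover have "G = (\<lambda>x. \<Sum>b\<in>insert b0 B. (if b = b0 then a else d b - a * c b) *\<^sub>R b x)"
  proof
    fix x
    have "(\<Sum>b\<in>B. (if b = b0 then a else d b - a * c b) *\<^sub>R b x)
        = (\<Sum>b\<in>B. d b *\<^sub>R b x - a *\<^sub>R (c b *\<^sub>R b x))"
      using insert.hyps(2) by (intro sum.cong) (auto simp: scaleR_diff_left)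
    then show "G x = (\<Sum>b\<in>insert b0 B. (if b = b0 then a else d b - a * c b) *\<^sub>R b x)"
      using insert.hyps unfolding G_def r_def
      by (simp add: d c sum_subtractf scaleR_sum_right sum_negf algebra_simps)
  qed
  ultimately show ?case using GV by (intro exI[of _ G]) auto
qed

text \<open>Every f in V agrees almost everywhere with a combination of \<open>B\<close>, and
  neither side notices the difference: the inner product ignores null sets, and so does
  \<open>l\<close>, being linear and zero on null functions.\<close>

lemma riesz_finite_dim:
  assumes VL2: "V \<subseteq> L2 S" and V: "fun_subspace V"
    and B: "finite B" "B \<subseteq> V"
    and span: "\<And>f. f \<in> V \<Longrightarrow> \<exists>c. AE x in lebS S. f x = (\<Sum>b\<in>B. c b *\<^sub>R b x)"
    and l: "linear_functional_on V l"
    and l_null: "\<And>f. f \<in> V \<Longrightarrow> AE x in lebS S. f x = 0 \<Longrightarrow> l f = 0"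
  shows "\<exists>g. g \<in> V \<and> (\<forall>f\<in>V. L2_inner S g f = l f)"
proof -
  note L2 = VL2[THEN subsetD]
  obtain g where g: "g \<in> V" "\<And>b. b \<in> B \<Longrightarrow> L2_inner S g b = l b"
    using riesz_on_basis[OF VL2 V B l l_null] by blast
  have "L2_inner S g f = l f" if f: "f \<in> V" for f
  proof -
    obtain c where c: "AE x in lebS S. f x = (\<Sum>b\<in>B. c b *\<^sub>R b x)" using span[OF f] by blast
    define s where "s = (\<lambda>x. \<Sum>b\<in>B. c b *\<^sub>R b x)"
    have s: "s \<in> V" "l s = (\<Sum>b\<in>B. c b * l b)"
      using linear_functional_sum[OF V l B] unfolding s_def by blast+
    have "L2_inner S g s = (\<Sum>b\<in>B. c b * L2_inner S g b)"
      using linear_functional_sum[OF V linear_functional_L2_inner[OF VL2 L2[OF g(1)]] B]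
      unfolding s_def by blast
    then have gs: "L2_inner S g s = l s" by (simp add: s g)
    have ms: "(\<lambda>x. (-1) *\<^sub>R s x) \<in> V" by (rule fun_subspaceD(3)[OF V s(1)])
    have "l (\<lambda>x. f x + (-1) *\<^sub>R s x) = 0"
      using c by (intro l_null fun_subspaceD(2)[OF V f ms]) (auto simp: s_def)
    then have "l f = l s"
      using linear_functional_onD(1)[OF l f ms] linear_functional_onD(2)[OF l s(1), of "-1"] by simp
    moreover have "L2_inner S g f = L2_inner S g s"
      using c by (intro L2_inner_cong_AE_right L2 f s g) (simp add: s_def)
    ultimately show ?thesis using gs by simp
  qed
  with g show ?thesis by blast
qed


section \<open>Test functions and weak derivatives\<close>

lemma partial_eq:
  assumes "(f has_derivative D) (at x)"
  shows "partial i f x = D (axis i 1)"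
  using frechet_derivative_at[OF assms] by (simp add: partial_def)

lemma partial_add:
  assumes "f differentiable (at x)" "g differentiable (at x)"
  shows "partial i (\<lambda>x. f x + g x) x = partial i f x + partial i g x"
  using has_derivative_add[OF frechet_derivative_works[THEN iffD1, OF assms(1)] frechet_derivative_works[THEN iffD1, OF assms(2)]]
  by (subst partial_eq) (auto simp: partial_def)

lemma partial_scale:
  assumes "f differentiable (at x)"
  shows "partial i (\<lambda>x. c * f x) x = c * partial i f x"
  using has_derivative_mult_right[OF frechet_derivative_works[THEN iffD1, OF assms], of c]
  by (subst partial_eq) (auto simp: partial_def)

lemma Ck_add: "Ck k f \<Longrightarrow> Ck k g \<Longrightarrow> Ck k (\<lambda>x. f x + g x)"
proof (induction k arbitrary: f g)
  case 0
  then show ?case by (auto intro: continuous_on_add)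
next
  case (Suc k)
  then have "partial i (\<lambda>x. f x + g x) = (\<lambda>x. partial i f x + partial i g x)" for i
    by (auto simp: partial_add)
  with Suc show ?case by auto
qed

lemma Ck_scale: "Ck k f \<Longrightarrow> Ck k (\<lambda>x. c * f x)"
proof (induction k arbitrary: f)
  case 0
  then show ?case by (auto intro: continuous_on_mult)
next
  case (Suc k)
  then have "partial i (\<lambda>x. c * f x) = (\<lambda>x. c * partial i f x)" for i
    by (auto simp: partial_scale)
  with Suc show ?case by auto
qed

lemma smooth_differentiable: "smooth f \<Longrightarrow> f differentiable (at x)"
  unfolding smooth_def by (metis Ck.simps(2))

lemma smooth_continuous: "smooth f \<Longrightarrow> continuous_on UNIV f"
  unfolding smooth_def by (metis Ck.simps(1))

lemma smooth_partial: "smooth f \<Longrightarrow> smooth (partial i f)"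
  unfolding smooth_def by (metis Ck.simps(2))

lemma smooth_add: "smooth f \<Longrightarrow> smooth g \<Longrightarrow> smooth (\<lambda>x. f x + g x)"
  by (simp add: smooth_def Ck_add)

lemma smooth_scale: "smooth f \<Longrightarrow> smooth (\<lambda>x. c * f x)"
  by (simp add: smooth_def Ck_scale)

lemma test_functions_smooth: "\<phi> \<in> test_functions S \<Longrightarrow> smooth \<phi>"
  by (cases S) auto

lemma test_functions_zero: "(\<lambda>x. 0) \<in> test_functions S"
proof -
  have "Ck k (\<lambda>x. 0)" for k
  proof (induction k)
    case (Suc k)
    have "partial i (\<lambda>x. 0) = (\<lambda>x. 0)" for i
      by (auto simp: partial_eq[OF has_derivative_const])
    with Suc show ?case by simp
  qed simp
  then show ?thesis by (cases S) (auto simp: smooth_def)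
qed

lemma test_functions_add:
  assumes "\<phi> \<in> test_functions S" "\<theta> \<in> test_functions S"
  shows "(\<lambda>x. \<phi> x + \<theta> x) \<in> test_functions S"
proof (cases S)
  case (Periodic a b)
  with assms show ?thesis by (auto intro: smooth_add)
next
  case (Homogeneous \<Omega>)
  let ?K = "closure {x. \<phi> x \<noteq> 0}" and ?L = "closure {x. \<theta> x \<noteq> 0}"
  have "closure {x. \<phi> x + \<theta> x \<noteq> 0} \<subseteq> closure ({x. \<phi> x \<noteq> 0} \<union> {x. \<theta> x \<noteq> 0})"
    by (rule closure_mono) auto
  then have sub: "closure {x. \<phi> x + \<theta> x \<noteq> 0} \<subseteq> ?K \<union> ?L"
    by simp
  moreover have "compact (?K \<union> ?L)" "?K \<union> ?L \<subseteq> \<Omega>"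
    using assms Homogeneous by (auto intro: compact_Un)
  ultimately have "compact (closure {x. \<phi> x + \<theta> x \<noteq> 0})" "closure {x. \<phi> x + \<theta> x \<noteq> 0} \<subseteq> \<Omega>"
    by (meson bounded_subset closed_closure compact_eq_bounded_closed, blast)
  with assms Homogeneous show ?thesis by (auto intro: smooth_add)
qed

lemma test_functions_scale:
  assumes "\<phi> \<in> test_functions S"
  shows "(\<lambda>x. c * \<phi> x) \<in> test_functions S"
proof (cases "c = 0")
  case True
  then show ?thesis using test_functions_zero by simp
next
  case False
  with assms show ?thesis by (cases S) (auto intro: smooth_scale)
qed

text \<open>Periodicity passes to the derivative by the chain rule with a translation. With
  homogeneous boundary conditions the function vanishes on the open complement of its support, hence
  so does its derivative.\<close>

lemma test_functions_partial:
  assumes "\<phi> \<in> test_functions S"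
  shows "partial i \<phi> \<in> test_functions S"
proof (cases S)
  case (Periodic a b)
  have "partial i \<phi> (x + axis j (b $ j - a $ j)) = partial i \<phi> x" for x j
  proof -
    let ?p = "axis j (b $ j - a $ j)"
    have "(\<phi> has_derivative frechet_derivative \<phi> (at (x + ?p))) (at (x + ?p))"
      using smooth_differentiable[OF test_functions_smooth[OF assms]] by (simp add: frechet_derivative_works)
    moreover have "((\<lambda>x. x + ?p) has_derivative (\<lambda>h. h)) (at x)"
      by (auto intro!: derivative_eq_intros)
    ultimately have "((\<lambda>x. \<phi> (x + ?p)) has_derivative frechet_derivative \<phi> (at (x + ?p))) (at x)"
      using has_derivative_compose by blast
    moreover have "(\<lambda>x. \<phi> (x + ?p)) = \<phi>" using assms Periodic by auto
    ultimately show ?thesis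
      using partial_eq[of \<phi> _ x i] by (simp add: partial_def)
  qed
  with assms Periodic show ?thesis by (auto intro: smooth_partial)
next
  case (Homogeneous \<Omega>)
  let ?K = "closure {x. \<phi> x \<noteq> 0}"
  have "partial i \<phi> x = 0" if "x \<notin> ?K" for x
  proof -
    have "((\<lambda>x. 0) has_derivative (\<lambda>h. 0)) (at x)" by simp
    then have "(\<phi> has_derivative (\<lambda>h. 0)) (at x)"
      by (rule has_derivative_transform_within_open[where s = "- ?K"])
        (use that closure_subset[of "{x. \<phi> x \<noteq> 0}"] in auto)
    then show ?thesis by (simp add: partial_eq)
  qed
  then have "closure {x. partial i \<phi> x \<noteq> 0} \<subseteq> ?K"
    by (intro closure_minimal) auto
  moreover have "compact ?K" "?K \<subseteq> \<Omega>" using assms Homogeneous by auto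
  ultimately have "compact (closure {x. partial i \<phi> x \<noteq> 0})" "closure {x. partial i \<phi> x \<noteq> 0} \<subseteq> \<Omega>"
    by (meson bounded_subset closed_closure compact_eq_bounded_closed, blast)
  with assms Homogeneous show ?thesis by (auto intro: smooth_partial)
qed

lemma test_functions_L2:
  assumes "admissible S" "\<phi> \<in> test_functions S"
  shows "\<phi> \<in> L2 S"
  using assms by (intro L2_continuous smooth_continuous test_functions_smooth)

lemma L2_vec:
  fixes f :: "real^2 \<Rightarrow> real^2"
  assumes "\<And>i. (\<lambda>x. f x $ i) \<in> L2 S"
  shows "f \<in> L2 S"
proof -
  have s: "(norm (f x))\<^sup>2 = (\<Sum>i\<in>UNIV. (norm (f x $ i))\<^sup>2)" for x
    by (simp add: norm_vec_def L2_set_def sum_nonneg)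
  have "(\<lambda>x. f x \<bullet> b) \<in> borel_measurable (lebS S)" if "b \<in> Basis" for b
    using that L2_measurable[OF assms] by (auto simp: Basis_vec_def inner_axis)
  then have "f \<in> borel_measurable (lebS S)"
    by (subst borel_measurable_euclidean_space) blast
  moreover have "integrable (lebS S) (\<lambda>x. (norm (f x))\<^sup>2)"
    unfolding s using assms by (intro Bochner_Integration.integrable_sum) (auto simp: L2_def)
  ultimately show ?thesis by (simp add: L2_def)
qed

lemma L2_inner_components:
  fixes f g :: "real^2 \<Rightarrow> real^2"
  assumes "f \<in> L2 S" "g \<in> L2 S"
  shows "L2_inner S f g = (\<Sum>i\<in>UNIV. L2_inner S (\<lambda>x. f x $ i) (\<lambda>x. g x $ i))"
  unfolding L2_inner_def inner_vec_def
  using L2_dot_integrable[OF L2_component[OF assms(1)] L2_component[OF assms(2)]]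
  by (intro Bochner_Integration.integral_sum)

lemma classical_grad_L2:
  assumes "admissible S" "\<phi> \<in> test_functions S"
  shows "classical_grad \<phi> \<in> L2 S"
  using assms by (intro L2_vec) (simp add: classical_grad_def test_functions_L2 test_functions_partial)

lemma classical_div_test_functions:
  fixes \<phi> :: "real^2 \<Rightarrow> real^2"
  assumes "\<And>i. (\<lambda>x. \<phi> x $ i) \<in> test_functions S"
  shows "classical_div \<phi> \<in> test_functions S"
proof -
  have "classical_div \<phi> = (\<lambda>x. partial 1 (\<lambda>y. \<phi> y $ 1) x + partial 2 (\<lambda>y. \<phi> y $ 2) x)"
    by (auto simp: classical_div_def sum_2)
  then show ?thesis using assms by (simp add: test_functions_add test_functions_partial)
qed

section \<open>Weak gradients and divergences\<close>

lemma is_weak_grad_iff: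
  "is_weak_grad S w g \<longleftrightarrow> g \<in> L2 S \<and>
     (\<forall>\<phi>\<in>test_functions S. \<forall>i. L2_inner S w (partial i \<phi>) = - L2_inner S (\<lambda>x. g x $ i) \<phi>)"
  by (simp add: is_weak_grad_def L2_inner_def)

lemma is_weak_div_iff:
  "is_weak_div S v d \<longleftrightarrow> d \<in> L2 S \<and>
     (\<forall>\<phi>\<in>test_functions S. L2_inner S v (classical_grad \<phi>) = - L2_inner S d \<phi>)"
  by (simp add: is_weak_div_def L2_inner_def)

lemma H1_grad:
  assumes "w \<in> H1 S"
  shows "w \<in> L2 S" "is_weak_grad S w (grad S w)" "grad S w \<in> L2 S"
proof -
  show "w \<in> L2 S" "is_weak_grad S w (grad S w)"
    using assms someI_ex[of "is_weak_grad S w"] by (auto simp: H1_def grad_def)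
  then show "grad S w \<in> L2 S" by (simp add: is_weak_grad_def)
qed

lemma Hdiv_wdiv:
  assumes "v \<in> Hdiv S"
  shows "v \<in> L2 S" "is_weak_div S v (wdiv S v)" "wdiv S v \<in> L2 S"
proof -
  show "v \<in> L2 S" "is_weak_div S v (wdiv S v)"
    using assms someI_ex[of "is_weak_div S v"] by (auto simp: Hdiv_def wdiv_def)
  then show "wdiv S v \<in> L2 S" by (simp add: is_weak_div_def)
qed

lemma V1_Hdiv: "v \<in> V1 S \<Longrightarrow> v \<in> Hdiv S"
  by (cases S) (auto simp: Hdiv_0_def)

text \<open>Stated for the relation and not for \<open>wdiv\<close>: the representative that
  \<open>wdiv\<close> chooses for a sum may differ from the sum of the representatives on a null
  set.\<close>

lemma is_weak_div_add:
  assumes "admissible S" "u \<in> L2 S" "v \<in> L2 S" "is_weak_div S u d" "is_weak_div S v e"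
  shows "is_weak_div S (\<lambda>x. u x + v x) (\<lambda>x. d x + e x)"
  using assms
  by (auto simp: is_weak_div_iff L2_add L2_inner_add_left classical_grad_L2 test_functions_L2)

lemma is_weak_div_scale:
  assumes "is_weak_div S u d"
  shows "is_weak_div S (\<lambda>x. c *\<^sub>R u x) (\<lambda>x. c * d x)"
  using assms L2_scale[of d S c] L2_inner_scale_left[of S c d]
  by (auto simp: is_weak_div_iff L2_inner_scale_left)

text \<open>The closure of the test functions in \<open>L2\<close>; it contains the divergence of every discrete
  velocity, so divergences are determined up to null sets without the fundamental lemma of the
  calculus of variations.\<close>

definition test_closure :: "flow_domain \<Rightarrow> (real^2 \<Rightarrow> real) set" where
  "test_closure S = {f \<in> L2 S. \<exists>\<phi>. (\<forall>n::nat. \<phi> n \<in> test_functions S) \<and>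
     (\<lambda>n. L2_norm S (\<lambda>x. \<phi> n x - f x)) \<longlonglongrightarrow> 0}"

lemma test_closure_add:
  assumes "admissible S" "f \<in> test_closure S" "g \<in> test_closure S"
  shows "(\<lambda>x. f x + g x) \<in> test_closure S"
proof -
  obtain \<phi> \<theta> where \<phi>: "\<And>n::nat. \<phi> n \<in> test_functions S"
      "(\<lambda>n. L2_norm S (\<lambda>x. \<phi> n x - f x)) \<longlonglongrightarrow> 0"
    and \<theta>: "\<And>n::nat. \<theta> n \<in> test_functions S" "(\<lambda>n. L2_norm S (\<lambda>x. \<theta> n x - g x)) \<longlonglongrightarrow> 0"
    and L2: "f \<in> L2 S" "g \<in> L2 S"
    using assms(2,3) by (auto simp: test_closure_def)
  have "(\<lambda>n. L2_norm S (\<lambda>x. (\<phi> n x + \<theta> n x) - (f x + g x))) \<longlonglongrightarrow> 0"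
  proof (rule Lim_null_comparison)
    show "(\<lambda>n. L2_norm S (\<lambda>x. \<phi> n x - f x) + L2_norm S (\<lambda>x. \<theta> n x - g x)) \<longlonglongrightarrow> 0"
      using tendsto_add[OF \<phi>(2) \<theta>(2)] by simp
    show "\<forall>\<^sub>F n in sequentially. norm (L2_norm S (\<lambda>x. (\<phi> n x + \<theta> n x) - (f x + g x)))
        \<le> L2_norm S (\<lambda>x. \<phi> n x - f x) + L2_norm S (\<lambda>x. \<theta> n x - g x)"
    proof (intro always_eventually allI)
      fix n
      have "L2_norm S (\<lambda>x. (\<phi> n x - f x) + (\<theta> n x - g x))
          \<le> L2_norm S (\<lambda>x. \<phi> n x - f x) + L2_norm S (\<lambda>x. \<theta> n x - g x)"
        by (intro L2_norm_triangle L2_diff L2 test_functions_L2 assms(1) \<phi>(1) \<theta>(1))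
      moreover have "(\<lambda>x. (\<phi> n x - f x) + (\<theta> n x - g x)) = (\<lambda>x. (\<phi> n x + \<theta> n x) - (f x + g x))"
        by auto
      ultimately show "norm (L2_norm S (\<lambda>x. (\<phi> n x + \<theta> n x) - (f x + g x)))
        \<le> L2_norm S (\<lambda>x. \<phi> n x - f x) + L2_norm S (\<lambda>x. \<theta> n x - g x)"
        by (simp add: L2_norm_nonneg)
    qed
  qed
  then show ?thesis
    using L2_add[OF L2] test_functions_add[OF \<phi>(1) \<theta>(1)] unfolding test_closure_def
    by (intro CollectI conjI exI[of _ "\<lambda>n x. \<phi> n x + \<theta> n x"]) auto
qed

lemma test_closure_scale:
  assumes "f \<in> test_closure S"
  shows "(\<lambda>x. c * f x) \<in> test_closure S"
proof -
  obtain \<phi> where \<phi>: "\<And>n::nat. \<phi> n \<in> test_functions S"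
      "(\<lambda>n. L2_norm S (\<lambda>x. \<phi> n x - f x)) \<longlonglongrightarrow> 0" and "f \<in> L2 S"
    using assms by (auto simp: test_closure_def)
  have "L2_norm S (\<lambda>x. c * \<phi> n x - c * f x) = \<bar>c\<bar> * L2_norm S (\<lambda>x. \<phi> n x - f x)" for n
    using L2_norm_scale[of S c "\<lambda>x. \<phi> n x - f x"] by (simp add: right_diff_distrib)
  then have "(\<lambda>n. L2_norm S (\<lambda>x. c * \<phi> n x - c * f x)) \<longlonglongrightarrow> 0"
    using tendsto_mult_left[OF \<phi>(2), of "\<bar>c\<bar>"] by simp
  then show ?thesis
    using L2_scale[OF \<open>f \<in> L2 S\<close>, of c] test_functions_scale[OF \<phi>(1)] unfolding test_closure_def
    by (intro CollectI conjI exI[of _ "\<lambda>n x. c * \<phi> n x"]) auto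
qed

text \<open>The difference e is orthogonal to every test function, in particular to those that
  approximate e; in the limit e is orthogonal to itself.\<close>

lemma test_closure_unique:
  assumes "admissible S" "f \<in> test_closure S" "g \<in> test_closure S"
    and eq: "\<And>\<phi>. \<phi> \<in> test_functions S \<Longrightarrow> L2_inner S f \<phi> = L2_inner S g \<phi>"
  shows "AE x in lebS S. f x = g x"
proof -
  have L2: "f \<in> L2 S" "g \<in> L2 S" using assms by (auto simp: test_closure_def)
  define e where "e = (\<lambda>x. f x + (-1) * g x)"
  have "e \<in> test_closure S"
    unfolding e_def by (intro test_closure_add test_closure_scale assms)
  then obtain \<phi> where \<phi>: "\<And>n::nat. \<phi> n \<in> test_functions S"
      "(\<lambda>n. L2_norm S (\<lambda>x. \<phi> n x - e x)) \<longlonglongrightarrow> 0" and e: "e \<in> L2 S"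
    by (auto simp: test_closure_def)
  have "L2_inner S e (\<phi> n) = 0" for n
  proof -
    have "L2_inner S e (\<phi> n) = L2_inner S (\<lambda>x. f x - g x) (\<phi> n)" by (simp add: e_def)
    then show ?thesis
      using eq[OF \<phi>(1)] by (simp add: L2_inner_diff_left L2 test_functions_L2 assms(1) \<phi>(1))
  qed
  moreover have "(\<lambda>n. L2_inner S e (\<phi> n)) \<longlonglongrightarrow> L2_inner S e e"
    by (rule tendsto_L2_inner[OF test_functions_L2[OF assms(1) \<phi>(1)] e e \<phi>(2)])
  ultimately have "L2_inner S e e = 0"
    by (simp add: LIMSEQ_const_iff)
  then have "AE x in lebS S. e x = 0" by (rule L2_inner_self_eq_0[OF e])
  then show ?thesis by (simp add: e_def)
qed

text \<open>The divergences of the test fields in the definition of \<open>Hdiv_0\<close> are the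
  required approximations.\<close>

lemma Hdiv_0_wdiv_test_closure:
  assumes "admissible S" "v \<in> Hdiv_0 S"
  shows "wdiv S v \<in> test_closure S"
proof -
  obtain \<phi> where \<phi>: "\<And>n::nat. \<And>i. (\<lambda>x. \<phi> n x $ i) \<in> test_functions S"
    and lim: "(\<lambda>n. L2_norm S (\<lambda>x. classical_div (\<phi> n) x - wdiv S v x)) \<longlonglongrightarrow> 0"
    and "v \<in> Hdiv S"
    using assms(2) by (auto simp: Hdiv_0_def)
  then show ?thesis
    using Hdiv_wdiv(3)[of v S] classical_div_test_functions[OF \<phi>]
    unfolding test_closure_def by (intro CollectI conjI exI[of _ "\<lambda>n. classical_div (\<phi> n)"]) auto
qed

text \<open>The boundary condition is carried by v, so w may range over all of \<open>H1\<close>.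
  Each component of an approximating field is a test function for the matching component of the weak
  gradient.\<close>

lemma Hdiv_0_integration_by_parts:
  assumes S: "admissible S" and v: "v \<in> Hdiv_0 S" and w: "w \<in> H1 S"
  shows "L2_inner S (grad S w) v = - L2_inner S w (wdiv S v)"
proof -
  obtain \<phi> where \<phi>: "\<And>n::nat. \<And>i. (\<lambda>x. \<phi> n x $ i) \<in> test_functions S"
    and lim: "(\<lambda>n. L2_norm S (\<lambda>x. \<phi> n x - v x)) \<longlonglongrightarrow> 0"
      "(\<lambda>n. L2_norm S (\<lambda>x. classical_div (\<phi> n) x - wdiv S v x)) \<longlonglongrightarrow> 0"
    and "v \<in> Hdiv S"
    using v by (auto simp: Hdiv_0_def)
  note v = Hdiv_wdiv[OF \<open>v \<in> Hdiv S\<close>] and w = H1_grad[OF w]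
  have \<phi>L2: "\<phi> n \<in> L2 S" for n
    by (intro L2_vec test_functions_L2 S \<phi>)
  have div: "classical_div (\<phi> n) \<in> test_functions S" for n
    by (intro classical_div_test_functions \<phi>)
  have "L2_inner S (grad S w) (\<phi> n) = - L2_inner S w (classical_div (\<phi> n))" for n
  proof -
    have p: "partial i (\<lambda>x. \<phi> n x $ i) \<in> L2 S" for i
      by (intro test_functions_L2 test_functions_partial S \<phi>)
    have "L2_inner S w (classical_div (\<phi> n)) = (\<Sum>i\<in>UNIV. L2_inner S w (partial i (\<lambda>x. \<phi> n x $ i)))"
      using L2_dot_integrable[OF w(1) p]
      by (simp add: L2_inner_def classical_div_def sum_distrib_left)
    also have "\<dots> = (\<Sum>i\<in>UNIV. - L2_inner S (\<lambda>x. grad S w x $ i) (\<lambda>x. \<phi> n x $ i))"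
      using w(2) \<phi> by (simp add: is_weak_grad_iff)
    also have "\<dots> = - L2_inner S (grad S w) (\<phi> n)"
      by (simp add: L2_inner_components w \<phi>L2 sum_negf)
    finally show ?thesis by simp
  qed
  moreover have "(\<lambda>n. L2_inner S (grad S w) (\<phi> n)) \<longlonglongrightarrow> L2_inner S (grad S w) v"
    by (intro tendsto_L2_inner \<phi>L2 v w lim)
  moreover have "(\<lambda>n. - L2_inner S w (classical_div (\<phi> n))) \<longlonglongrightarrow> - L2_inner S w (wdiv S v)"
    by (intro tendsto_minus tendsto_L2_inner test_functions_L2 S div v w lim)
  ultimately show ?thesis using LIMSEQ_unique by fastforce
qed


section \<open>Trigonometric polynomials on the torus\<close>

definition phase :: "real^2 \<Rightarrow> (2 \<Rightarrow> int) \<Rightarrow> real^2 \<Rightarrow> real" where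
  "phase L k x = (\<Sum>i\<in>UNIV. 2 * pi * of_int (k i) / L $ i * x $ i)"

text \<open>The free phase shift covers the sines and lets differentiation act within the same
  \<open>F\<close>. With \<open>F\<close> as a parameter, finite sets of modes give the
  finite-dimensional spaces onto which \<psi> is projected. The zero function arises from amplitude
  zero, so this is a linear space only when \<open>F\<close> is nonempty.\<close>

inductive_set trig_poly :: "real^2 \<Rightarrow> (2 \<Rightarrow> int) set \<Rightarrow> (real^2 \<Rightarrow> real) set"
  for L :: "real^2" and F :: "(2 \<Rightarrow> int) set" where
  wave: "k \<in> F \<Longrightarrow> (\<lambda>x. c * cos (phase L k x + \<theta>)) \<in> trig_poly L F"
| add: "f \<in> trig_poly L F \<Longrightarrow> g \<in> trig_poly L F \<Longrightarrow> (\<lambda>x. f x + g x) \<in> trig_poly L F"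

lemma phase_add: "phase L k (x + y) = phase L k x + phase L k y"
  by (simp add: phase_def sum.distrib distrib_left)

lemma phase_axis: "phase L k (axis i s) = 2 * pi * of_int (k i) / L $ i * s"
proof -
  have "phase L k (axis i s) = (\<Sum>j\<in>UNIV. if j = i then 2 * pi * of_int (k i) / L $ i * s else 0)"
    unfolding phase_def by (intro sum.cong) (auto simp: axis_def)
  then show ?thesis by simp
qed

lemma bounded_linear_phase: "bounded_linear (phase L k)"
proof -
  have "linear (phase L k)"
    by (intro linearI phase_add) (simp add: phase_def sum_distrib_left mult_ac)
  then show ?thesis by (simp add: linear_conv_bounded_linear)
qed

lemma wave_has_derivative:
  "((\<lambda>x. c * cos (phase L k x + \<theta>)) has_derivative
     (\<lambda>h. c * - (sin (phase L k x + \<theta>) * phase L k h))) (at x)"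
proof -
  have "(phase L k has_derivative phase L k) (at x)"
    by (rule bounded_linear.has_derivative[OF bounded_linear_phase has_derivative_ident])
  then show ?thesis by (auto intro!: derivative_eq_intros)
qed

text \<open>Differentiation is a quarter-period shift times a factor; the frequency is unchanged,
  which is why each \<open>trig_poly L F\<close> is closed under partial derivatives.\<close>

lemma partial_wave:
  "partial i (\<lambda>x. c * cos (phase L k x + \<theta>)) x
    = (c * (2 * pi * of_int (k i) / L $ i)) * cos (phase L k x + (\<theta> + pi / 2))"
proof -
  have "cos (phase L k x + (\<theta> + pi / 2)) = - sin (phase L k x + \<theta>)"
    using minus_sin_cos_eq[of "phase L k x + \<theta>"] by (simp add: add.assoc)
  then show ?thesis
    by (simp add: partial_eq[OF wave_has_derivative] phase_axis)
qed

lemma trig_poly_differentiable: "f \<in> trig_poly L F \<Longrightarrow> f differentiable (at x)"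
  by (induction rule: trig_poly.induct) (auto simp: differentiable_def intro: wave_has_derivative
      has_derivative_add)

lemma trig_poly_partial: "f \<in> trig_poly L F \<Longrightarrow> partial i f \<in> trig_poly L F"
proof (induction rule: trig_poly.induct)
  case (wave k c \<theta>)
  have "partial i (\<lambda>x. c * cos (phase L k x + \<theta>))
      = (\<lambda>x. (c * (2 * pi * of_int (k i) / L $ i)) * cos (phase L k x + (\<theta> + pi / 2)))"
    by (rule ext) (rule partial_wave)
  with trig_poly.wave[OF wave] show ?case by metis
next
  case (add f g)
  then have "partial i (\<lambda>x. f x + g x) = (\<lambda>x. partial i f x + partial i g x)"
    by (auto simp: partial_add trig_poly_differentiable)
  with add show ?case by (auto intro: trig_poly.add)
qed

lemma trig_poly_continuous: "f \<in> trig_poly L F \<Longrightarrow> continuous_on UNIV f"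
  by (simp add: continuous_on_eq_continuous_within differentiable_imp_continuous_within
      trig_poly_differentiable)

lemma trig_poly_smooth: "f \<in> trig_poly L F \<Longrightarrow> smooth f"
proof -
  have "f \<in> trig_poly L F \<Longrightarrow> Ck k f" for k f
    by (induction k arbitrary: f)
      (auto simp: trig_poly_continuous trig_poly_differentiable trig_poly_partial)
  then show "f \<in> trig_poly L F \<Longrightarrow> smooth f" by (simp add: smooth_def)
qed

lemma trig_poly_periodic:
  assumes "f \<in> trig_poly L F" "L $ i \<noteq> 0"
  shows "f (x + axis i (L $ i)) = f x"
  using assms
proof (induction rule: trig_poly.induct)
  case (wave k c \<theta>)
  have "phase L k (x + axis i (L $ i)) + \<theta> = (phase L k x + \<theta>) + 2 * pi * of_int (k i)"
    using wave by (simp add: phase_add phase_axis)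
  then show ?case by (simp only: cos_add[of "phase L k x + \<theta>"]) simp
qed auto

lemma trig_poly_test_functions:
  assumes "admissible (Periodic a b)" "f \<in> trig_poly (b - a) F"
  shows "f \<in> test_functions (Periodic a b)"
  using assms trig_poly_smooth[OF assms(2)] trig_poly_periodic[OF assms(2)]
  by (auto simp: less_imp_neq[symmetric])

lemma trig_poly_mono: "f \<in> trig_poly L F \<Longrightarrow> F \<subseteq> G \<Longrightarrow> f \<in> trig_poly L G"
  by (induction rule: trig_poly.induct) (auto intro: trig_poly.intros)

lemma trig_poly_scale: "f \<in> trig_poly L F \<Longrightarrow> (\<lambda>x. c * f x) \<in> trig_poly L F"
proof (induction rule: trig_poly.induct)
  case (wave k d \<theta>)
  then show ?case using trig_poly.wave[of k F "c * d" L \<theta>] by (simp add: mult.assoc)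
next
  case (add f g)
  then show ?case using trig_poly.add[of "\<lambda>x. c * f x" L F "\<lambda>x. c * g x"] by (simp add: distrib_left)
qed

lemma trig_poly_finite_modes:
  "f \<in> trig_poly L UNIV \<Longrightarrow> \<exists>F. finite F \<and> f \<in> trig_poly L F"
proof (induction rule: trig_poly.induct)
  case (wave k c \<theta>)
  show ?case by (intro exI[of _ "{k}"]) (auto intro: trig_poly.wave)
next
  case (add f g)
  then obtain F G where "finite F" "f \<in> trig_poly L F" "finite G" "g \<in> trig_poly L G" by blast
  then show ?case
    by (intro exI[of _ "F \<union> G"]) (auto intro: trig_poly.add trig_poly_mono)
qed

text \<open>Product-to-sum: waves of frequencies k and l multiply to waves of frequencies k + l and
  k - l. The product may thus leave a given set of modes, hence \<open>UNIV\<close>.\<close>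

lemma trig_poly_mult:
  assumes "f \<in> trig_poly L UNIV" "g \<in> trig_poly L UNIV"
  shows "(\<lambda>x. f x * g x) \<in> trig_poly L UNIV"
  using assms(1)
proof (induction rule: trig_poly.induct)
  case (wave k c \<theta>)
  show ?case using assms(2)
  proof (induction rule: trig_poly.induct)
    case (wave l d \<eta>)
    have ph: "phase L (\<lambda>i. k i + l i) x = phase L k x + phase L l x"
      "phase L (\<lambda>i. k i - l i) x = phase L k x - phase L l x" for x
      by (simp_all add: phase_def sum_2 algebra_simps add_divide_distrib diff_divide_distrib)
    have "(\<lambda>x. c * cos (phase L k x + \<theta>) * (d * cos (phase L l x + \<eta>)))
      = (\<lambda>x. (c * d / 2) * cos (phase L (\<lambda>i. k i + l i) x + (\<theta> + \<eta>))
           + (c * d / 2) * cos (phase L (\<lambda>i. k i - l i) x + (\<theta> - \<eta>)))"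
    proof
      fix x
      have "cos (phase L (\<lambda>i. k i + l i) x + (\<theta> + \<eta>)) = cos ((phase L k x + \<theta>) + (phase L l x + \<eta>))"
        "cos (phase L (\<lambda>i. k i - l i) x + (\<theta> - \<eta>)) = cos ((phase L k x + \<theta>) - (phase L l x + \<eta>))"
        unfolding ph by (simp_all add: algebra_simps)
      then show "c * cos (phase L k x + \<theta>) * (d * cos (phase L l x + \<eta>))
          = (c * d / 2) * cos (phase L (\<lambda>i. k i + l i) x + (\<theta> + \<eta>))
           + (c * d / 2) * cos (phase L (\<lambda>i. k i - l i) x + (\<theta> - \<eta>))"
        by (simp only: cos_add[of "phase L k x + \<theta>"] cos_diff[of "phase L k x + \<theta>"])
          (simp add: algebra_simps)
    qed
    then show ?case by (simp only:) (intro trig_poly.intros UNIV_I)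
  next
    case (add g h)
    then show ?case
      using trig_poly.add[OF add.IH] by (simp add: distrib_left)
  qed
next
  case (add f h)
  then show ?case using trig_poly.add[OF add.IH] by (simp add: distrib_right)
qed

lemma trig_poly_const: "(\<lambda>x. c) \<in> trig_poly L UNIV"
  using trig_poly.wave[of "\<lambda>_. 0" UNIV c L 0] by (simp add: phase_def)

text \<open>The box stretched by s in direction \<open>i\<close> is cut once at \<open>b $ i\<close>
  and once at \<open>a $ i + s\<close>. Each cut leaves a copy of the original box, unshifted and
  shifted by s respectively, and an end slab; the two slabs differ by one period.\<close>

lemma integral_periodic_shift:
  fixes G :: "real^2 \<Rightarrow> real"
  assumes G: "continuous_on UNIV G" and ab: "\<And>j. a $ j < b $ j" and "0 \<le> s"
    and per: "\<And>x. G (x + axis i (b $ i - a $ i)) = G x"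
  shows "integral (cbox a b) (\<lambda>x. G (x + axis i s)) = integral (cbox a b) G"
proof -
  let ?p = "axis i s :: real^2" and ?q = "axis i (b $ i - a $ i) :: real^2"
  have int: "G integrable_on cbox c d" for c d
    by (intro integrable_continuous continuous_on_subset[OF G]) auto
  have ax: "x \<bullet> axis i 1 = x $ i" for x :: "real^2" by (simp add: inner_axis)
  have basis: "(axis i 1 :: real^2) \<in> Basis" by (simp add: axis_in_Basis_iff)
  have "integral (cbox a (b + ?p)) G = integral (cbox a b) G + integral (cbox (a + ?q) (b + ?p)) G"
  proof -
    have "cbox a (b + ?p) \<inter> {x. x \<bullet> axis i 1 \<le> b $ i} = cbox a b"
      "cbox a (b + ?p) \<inter> {x. x \<bullet> axis i 1 \<ge> b $ i} = cbox (a + ?q) (b + ?p)"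
      unfolding ax using \<open>0 \<le> s\<close> ab[of 1] ab[of 2] exhaust_2[of i]
      by (auto simp: mem_box_cart forall_2 axis_def)
    then show ?thesis using integral_split[OF int basis, of a "b + ?p" "b $ i"] by simp
  qed
  moreover have "integral (cbox a (b + ?p)) G
      = integral (cbox a (b + ?p - ?q)) G + integral (cbox (a + ?p) (b + ?p)) G"
  proof -
    have "cbox a (b + ?p) \<inter> {x. x \<bullet> axis i 1 \<le> a $ i + s} = cbox a (b + ?p - ?q)"
      "cbox a (b + ?p) \<inter> {x. x \<bullet> axis i 1 \<ge> a $ i + s} = cbox (a + ?p) (b + ?p)"
      unfolding ax using \<open>0 \<le> s\<close> ab[of 1] ab[of 2] exhaust_2[of i]
      by (auto simp: mem_box_cart forall_2 axis_def)
    then show ?thesis using integral_split[OF int basis, of a "b + ?p" "a $ i + s"] by simp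
  qed
  moreover have "integral (cbox (a + ?q) (b + ?p)) G = integral (cbox a (b + ?p - ?q)) G"
    using integral_shift_cbox[of "a + ?q" ?q "b + ?p" G] by (simp add: per)
  moreover have "integral (cbox a b) (\<lambda>x. G (x + ?p)) = integral (cbox (a + ?p) (b + ?p)) G"
    using integral_shift_cbox[of "a + ?p" ?p "b + ?p" G] by simp
  ultimately show ?thesis by simp
qed

lemma integral_wave_eq_0:
  assumes S: "admissible (Periodic a b)" and k: "k i \<noteq> 0"
  shows "(\<integral>x. cos (phase (b - a) k x + \<theta>) \<partial>lebS (Periodic a b)) = 0"
proof -
  have ab: "a $ j < b $ j" for j using S by simp
  let ?G = "\<lambda>x. cos (phase (b - a) k x + \<theta>)"
  have tp: "?G \<in> trig_poly (b - a) UNIV" using trig_poly.wave[of k UNIV 1] by simp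
  \<comment> \<open>Half a period of the wave changes its sign.\<close>
  define s where "s = (b $ i - a $ i) / (2 * \<bar>of_int (k i)\<bar>)"
  have s: "0 \<le> s" using ab[of i] by (simp add: s_def)
  have "?G (x + axis i s) = - ?G x" for x
  proof -
    have "phase (b - a) k (axis i s) = pi * sgn (of_int (k i))"
      using ab[of i] k unfolding phase_axis s_def by (auto simp: field_simps sgn_if)
    then have "phase (b - a) k (x + axis i s) + \<theta> = (phase (b - a) k x + \<theta>) + pi \<or>
      phase (b - a) k (x + axis i s) + \<theta> = (phase (b - a) k x + \<theta>) - pi"
      using k by (auto simp: phase_add sgn_if)
    moreover have "cos (y - pi) = - cos y" for y :: real by (simp add: cos_diff)
    ultimately show ?thesis by (metis cos_periodic_pi)
  qed
  moreover have "integral (cbox a b) (\<lambda>x. ?G (x + axis i s)) = integral (cbox a b) ?G"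
    using trig_poly_periodic[OF tp, of i] ab[of i]
    by (intro integral_periodic_shift trig_poly_continuous[OF tp] ab s) auto
  ultimately have "integral (cbox a b) ?G = 0" by simp
  moreover have "integrable (lebS (Periodic a b)) ?G"
  proof -
    interpret finite_measure "lebS (Periodic a b)" by (rule finite_measure_lebS[OF S])
    have "?G \<in> borel_measurable (lebS (Periodic a b))"
      by (rule L2_measurable[OF L2_continuous[OF S trig_poly_continuous[OF tp]]])
    then show ?thesis by (intro integrable_const_bound[where B = 1]) auto
  qed
  \<comment> \<open>The shift was carried out with the gauge integral over the closed box;
    integrability identifies it with the Lebesgue integral over the open box.\<close>
  ultimately show ?thesis
    using lebesgue_integral_eq_integral[of "box a b" ?G] integral_open_interval[of a b ?G] by simp
qed

lemma trig_poly_L2: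
  assumes "admissible (Periodic a b)" "f \<in> trig_poly L F"
  shows "f \<in> L2 (Periodic a b)"
  by (rule L2_continuous[OF assms(1) trig_poly_continuous[OF assms(2)]])

text \<open>The derivative of a wave is zero if \<open>k i = 0\<close>, and otherwise a multiple of
  a wave of the same frequency, which has mean zero. Integrability is carried along so that the
  induction can split the integral of a sum.\<close>

lemma integral_partial_trig_poly:
  assumes S: "admissible (Periodic a b)" and f: "f \<in> trig_poly (b - a) F"
  shows "integrable (lebS (Periodic a b)) (partial i f) \<and>
     (\<integral>x. partial i f x \<partial>lebS (Periodic a b)) = 0"
  using f
proof (induction rule: trig_poly.induct)
  case (wave k c \<theta>)
  have "integrable (lebS (Periodic a b)) (\<lambda>x. g x * 1)" if "g \<in> trig_poly (b - a) F" for g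
    using L2_dot_integrable[OF trig_poly_L2[OF S that] trig_poly_L2[OF S trig_poly_const[of 1]]] by simp
  then have "integrable (lebS (Periodic a b)) (partial i (\<lambda>x. c * cos (phase (b - a) k x + \<theta>)))"
    using trig_poly_partial[OF trig_poly.wave[OF wave]] by auto
  moreover have "(\<integral>x. partial i (\<lambda>x. c * cos (phase (b - a) k x + \<theta>)) x \<partial>lebS (Periodic a b)) = 0"
    using integral_wave_eq_0[OF S, of k i "\<theta> + pi / 2"]
    by (cases "k i = 0") (simp_all add: partial_wave)
  ultimately show ?case by blast
next
  case (add f g)
  then have "partial i (\<lambda>x. f x + g x) = (\<lambda>x. partial i f x + partial i g x)"
    by (auto simp: partial_add trig_poly_differentiable)
  with add show ?case by simp
qed

text \<open>Product rule for f g, itself a trigonometric polynomial, so that its derivative has mean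
  zero.\<close>

lemma trig_poly_integration_by_parts:
  assumes S: "admissible (Periodic a b)"
    and f: "f \<in> trig_poly (b - a) F" and g: "g \<in> trig_poly (b - a) F"
  shows "L2_inner (Periodic a b) (partial i f) g = - L2_inner (Periodic a b) f (partial i g)"
proof -
  have fg: "f \<in> trig_poly (b - a) UNIV" "g \<in> trig_poly (b - a) UNIV"
    using f g trig_poly_mono by blast+
  have "partial i (\<lambda>x. f x * g x) = (\<lambda>x. partial i f x * g x + f x * partial i g x)"
  proof
    fix x
    have "(f has_derivative frechet_derivative f (at x)) (at x)"
      "(g has_derivative frechet_derivative g (at x)) (at x)"
      using trig_poly_differentiable f g by (auto simp flip: frechet_derivative_works)
    from has_derivative_mult[OF this]
    show "partial i (\<lambda>x. f x * g x) x = partial i f x * g x + f x * partial i g x"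
      by (subst partial_eq) (auto simp: partial_def add.commute)
  qed
  then have "(\<integral>x. partial i f x * g x + f x * partial i g x \<partial>lebS (Periodic a b)) = 0"
    using integral_partial_trig_poly[OF S trig_poly_mult[OF fg], of i] by simp
  moreover have "integrable (lebS (Periodic a b)) (\<lambda>x. partial i f x * g x)"
    "integrable (lebS (Periodic a b)) (\<lambda>x. f x * partial i g x)"
    using L2_dot_integrable[OF trig_poly_L2[OF S trig_poly_partial[OF f]] trig_poly_L2[OF S g]]
      L2_dot_integrable[OF trig_poly_L2[OF S f] trig_poly_L2[OF S trig_poly_partial[OF g]]]
    by auto
  ultimately show ?thesis by (simp add: L2_inner_def)
qed

section \<open>Projection onto finitely many Fourier modes\<close>

lemma trig_poly_subspace: "F \<noteq> {} \<Longrightarrow> fun_subspace (trig_poly L F)"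
proof -
  assume "F \<noteq> {}"
  then obtain k where "k \<in> F" by blast
  from trig_poly.wave[OF this, of 0] show ?thesis
    by (auto simp: fun_subspace_def intro: trig_poly.add trig_poly_scale)
qed

text \<open>The addition formula writes every shifted wave through the cosine and sine of its phase.
  Coefficients are indexed by functions, not by frequencies, since different frequencies may give
  the same function, as k and -k do for the cosine.\<close>

lemma trig_poly_spanning:
  fixes L :: "real^2" and F :: "(2 \<Rightarrow> int) set"
  assumes "finite F"
  obtains B where "finite B" "B \<subseteq> trig_poly L F"
    "\<And>f. f \<in> trig_poly L F \<Longrightarrow> \<exists>c. f = (\<lambda>x. \<Sum>b\<in>B. c b *\<^sub>R b x)"
proof
  let ?C = "\<lambda>k x. cos (phase L k x)" and ?D = "\<lambda>k x. sin (phase L k x)"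
  let ?B = "?C ` F \<union> ?D ` F"
  show fin: "finite ?B" using assms by auto
  have "?C k \<in> trig_poly L F" "?D k \<in> trig_poly L F" if "k \<in> F" for k
    using trig_poly.wave[OF that, of 1 L 0] trig_poly.wave[OF that, of 1 L "- (pi / 2)"]
    by (simp_all add: cos_diff)
  then show "?B \<subseteq> trig_poly L F" by auto
  have mem: "\<exists>c. (\<lambda>x. d * b x) = (\<lambda>x. \<Sum>b\<in>?B. c b *\<^sub>R b x)" if "b \<in> ?B" for b d
  proof (intro exI ext)
    fix x
    have "(\<Sum>b'\<in>?B. (if b' = b then d else 0) *\<^sub>R b' x) = (\<Sum>b'\<in>?B. if b' = b then d * b x else 0)"
      by (intro sum.cong) auto
    then show "d * b x = (\<Sum>b'\<in>?B. (if b' = b then d else 0) *\<^sub>R b' x)"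
      using that fin by simp
  qed
  have plus: "\<exists>c. (\<lambda>x. f x + g x) = (\<lambda>x. \<Sum>b\<in>?B. c b *\<^sub>R b x)"
    if fg: "\<exists>c. f = (\<lambda>x. \<Sum>b\<in>?B. c b *\<^sub>R b x)" "\<exists>c. g = (\<lambda>x. \<Sum>b\<in>?B. c b *\<^sub>R b x)" for f g
  proof -
    obtain c where "f = (\<lambda>x. \<Sum>b\<in>?B. c b *\<^sub>R b x)" using fg(1) by blast
    moreover obtain d where "g = (\<lambda>x. \<Sum>b\<in>?B. d b *\<^sub>R b x)" using fg(2) by blast
    ultimately show ?thesis
      by (intro exI[of _ "\<lambda>b. c b + d b"]) (simp only: sum.distrib scaleR_add_left)
  qed
  show "\<exists>c. f = (\<lambda>x. \<Sum>b\<in>?B. c b *\<^sub>R b x)" if "f \<in> trig_poly L F" for f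
    using that
  proof (induction rule: trig_poly.induct)
    case (wave k c \<theta>)
    have eq: "(\<lambda>x. c * cos (phase L k x + \<theta>))
        = (\<lambda>x. (c * cos \<theta>) * ?C k x + (- c * sin \<theta>) * ?D k x)"
      by (intro ext) (simp add: cos_add algebra_simps)
    show ?case unfolding eq by (rule plus[OF mem mem]) (use wave in auto)
  next
    case (add f g)
    show ?case by (rule plus[OF add.IH])
  qed
qed

text \<open>The last hypothesis says that w - u is orthogonal to u, as for a projection u of w;
  Cauchy-Schwarz and division by the norm of u finish.\<close>

lemma L2_norm_projection_le:
  assumes "u \<in> L2 S" "w \<in> L2 S" "L2_inner S u u = L2_inner S w u"
  shows "L2_norm S u \<le> L2_norm S w"
proof (cases "L2_norm S u = 0")
  case False
  have "L2_norm S u * L2_norm S u \<le> L2_norm S w * L2_norm S u"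
    using L2_inner_le_norm[OF assms(2,1)] assms(3) L2_norm_power2[of S u]
    by (simp add: power2_eq_square)
  then show ?thesis
    using False L2_norm_nonneg[of S u] by (simp add: mult_le_cancel_right)
qed (simp add: L2_norm_nonneg)

text \<open>The projection onto a finite set of Fourier modes commutes with differentiation.\<close>

lemma trig_poly_projection:
  assumes S: "admissible (Periodic a b)" and w: "w \<in> H1 (Periodic a b)"
    and F: "finite F" "F \<noteq> {}"
  obtains \<phi> where "\<phi> \<in> trig_poly (b - a) F"
    "L2_norm (Periodic a b) \<phi> \<le> L2_norm (Periodic a b) w"
    "\<And>\<tau>. \<tau> \<in> trig_poly (b - a) F \<Longrightarrow> L2_inner (Periodic a b) \<phi> \<tau> = L2_inner (Periodic a b) w \<tau>"
    "\<And>i. L2_norm (Periodic a b) (partial i \<phi>)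
        \<le> L2_norm (Periodic a b) (\<lambda>x. grad (Periodic a b) w x $ i)"
    "\<And>i \<tau>. \<tau> \<in> trig_poly (b - a) F \<Longrightarrow> L2_inner (Periodic a b) (partial i \<phi>) \<tau>
        = L2_inner (Periodic a b) (\<lambda>x. grad (Periodic a b) w x $ i) \<tau>"
proof -
  let ?S = "Periodic a b" and ?V = "trig_poly (b - a) F"
  note w = H1_grad[OF w]
  have VL2: "?V \<subseteq> L2 ?S" using trig_poly_L2[OF S] by blast
  note L2 = VL2[THEN subsetD]
  obtain B where B: "finite B" "B \<subseteq> ?V"
    and span: "\<And>f. f \<in> ?V \<Longrightarrow> \<exists>c. f = (\<lambda>x. \<Sum>b\<in>B. c b *\<^sub>R b x)"
    using trig_poly_spanning[OF F(1)] by blast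
  have "\<exists>c. AE x in lebS ?S. f x = (\<Sum>b\<in>B. c b *\<^sub>R b x)" if f: "f \<in> ?V" for f
  proof -
    obtain c where "f = (\<lambda>x. \<Sum>b\<in>B. c b *\<^sub>R b x)" using span[OF f] by blast
    then show ?thesis by (intro exI[of _ c] AE_I2) simp
  qed
  moreover have "L2_inner ?S w f = 0" if "f \<in> ?V" "AE x in lebS ?S. f x = 0" for f
    using L2_inner_cong_AE_right[OF L2[OF that(1)] L2_zero w(1) that(2)] by (simp add: L2_inner_def)
  ultimately obtain \<phi> where \<phi>: "\<phi> \<in> ?V" "\<And>\<tau>. \<tau> \<in> ?V \<Longrightarrow> L2_inner ?S \<phi> \<tau> = L2_inner ?S w \<tau>"
    using riesz_finite_dim[OF VL2 trig_poly_subspace[OF F(2)] B _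
        linear_functional_L2_inner[OF VL2 w(1)]] by blast
  have part: "L2_inner ?S (partial i \<phi>) \<tau> = L2_inner ?S (\<lambda>x. grad ?S w x $ i) \<tau>"
    if "\<tau> \<in> ?V" for i \<tau>
  proof -
    have "L2_inner ?S (partial i \<phi>) \<tau> = - L2_inner ?S \<phi> (partial i \<tau>)"
      by (rule trig_poly_integration_by_parts[OF S \<phi>(1) that])
    \<comment> \<open>The derivative now falls on \<tau>, and \<open>partial i \<tau>\<close> still
      lies in \<open>?V\<close>, so the property defining \<phi> applies.\<close>
    also have "\<dots> = - L2_inner ?S w (partial i \<tau>)"
      by (simp add: \<phi>(2) trig_poly_partial that)
    also have "\<dots> = L2_inner ?S (\<lambda>x. grad ?S w x $ i) \<tau>"
      using w(2) trig_poly_test_functions[OF S that] by (simp add: is_weak_grad_iff)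
    finally show ?thesis .
  qed
  show thesis
  proof (rule that[OF \<phi>(1) _ \<phi>(2) _ part])
    show "L2_norm ?S \<phi> \<le> L2_norm ?S w"
      by (intro L2_norm_projection_le L2 \<phi> w)
    \<comment> \<open>By \<open>part\<close>, the derivative of \<phi> is itself the projection of a
      component of the weak gradient.\<close>
    show "L2_norm ?S (partial i \<phi>) \<le> L2_norm ?S (\<lambda>x. grad ?S w x $ i)" for i
      by (intro L2_norm_projection_le L2 trig_poly_partial \<phi> L2_component w part)
  qed
qed

section \<open>Density of trigonometric polynomials\<close>

definition torus_map :: "real^2 \<Rightarrow> real^2 \<Rightarrow> complex \<times> complex" where
  "torus_map L x = (cis (2 * pi / L $ 1 * x $ 1), cis (2 * pi / L $ 2 * x $ 2))"

lemma cos_sin_trig_poly: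
  "(\<lambda>x. cos (2 * pi / L $ i * x $ i)) \<in> trig_poly L UNIV"
  "(\<lambda>x. sin (2 * pi / L $ i * x $ i)) \<in> trig_poly L UNIV"
proof -
  define k :: "2 \<Rightarrow> int" where "k = (\<lambda>j. if j = i then 1 else 0)"
  have "phase L k x = (\<Sum>j\<in>UNIV. if j = i then 2 * pi / L $ i * x $ i else 0)" for x
    unfolding phase_def k_def by (intro sum.cong) auto
  then have "phase L k x = 2 * pi / L $ i * x $ i" for x
    by simp
  then show "(\<lambda>x. cos (2 * pi / L $ i * x $ i)) \<in> trig_poly L UNIV"
    "(\<lambda>x. sin (2 * pi / L $ i * x $ i)) \<in> trig_poly L UNIV"
    using trig_poly.wave[of k UNIV 1 L 0] trig_poly.wave[of k UNIV 1 L "- (pi / 2)"]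
    by (simp_all add: cos_diff)
qed

text \<open>\<open>torus_map L\<close> wraps the plane onto a torus in a real four-dimensional
  space, with the basic cosines and sines as coordinates. Polynomials in these are trigonometric
  polynomials because sums and products stay in \<open>trig_poly L UNIV\<close>.\<close>

lemma polynomial_torus_map:
  assumes "real_polynomial_function g"
  shows "(\<lambda>x. g (torus_map L x)) \<in> trig_poly L UNIV"
  using assms
proof (induction rule: real_polynomial_function.induct)
  case (linear f)
  have decomp: "torus_map L x = cos (2 * pi / L $ 1 * x $ 1) *\<^sub>R (1, 0)
      + sin (2 * pi / L $ 1 * x $ 1) *\<^sub>R (\<i>, 0)
      + (cos (2 * pi / L $ 2 * x $ 2) *\<^sub>R (0, 1) + sin (2 * pi / L $ 2 * x $ 2) *\<^sub>R (0, \<i>))" for x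
    by (simp add: torus_map_def complex_eq_iff)
  have "(\<lambda>x. f (torus_map L x)) = (\<lambda>x. f (1, 0) * cos (2 * pi / L $ 1 * x $ 1)
      + f (\<i>, 0) * sin (2 * pi / L $ 1 * x $ 1)
      + (f (0, 1) * cos (2 * pi / L $ 2 * x $ 2) + f (0, \<i>) * sin (2 * pi / L $ 2 * x $ 2)))"
    unfolding decomp bounded_linear.linear[OF linear, THEN linear_add]
      bounded_linear.linear[OF linear, THEN linear_scale] real_scaleR_def
    by (simp only: mult.commute)
  moreover have "\<dots> \<in> trig_poly L UNIV"
    by (rule trig_poly.add[OF trig_poly.add[OF trig_poly_scale trig_poly_scale]
          trig_poly.add[OF trig_poly_scale trig_poly_scale]]; rule cos_sin_trig_poly)
  ultimately show ?case by (simp only:)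
next
  case (const c)
  show ?case by (rule trig_poly_const)
next
  case (add f g)
  show ?case by (rule trig_poly.add[OF add.IH])
next
  case (mult f g)
  show ?case by (rule trig_poly_mult[OF mult.IH])
qed

text \<open>Points with the same image differ in each coordinate by an integer multiple of the
  period. If one of them is interior, each difference is smaller than a period, so the integer is
  zero. Distinct points are thus identified only on the boundary.\<close>

lemma torus_map_eq_imp:
  assumes ab: "\<And>j. a $ j < b $ j" and "x \<in> cbox a b" "y \<in> cbox a b"
    and eq: "torus_map (b - a) x = torus_map (b - a) y"
  shows "x = y \<or> x \<notin> box a b \<and> y \<notin> box a b"
proof (rule disjCI)
  assume "\<not> (x \<notin> box a b \<and> y \<notin> box a b)"
  then have box: "x \<in> box a b \<or> y \<in> box a b" by blast
  have "x $ i = y $ i" for i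
  proof -
    let ?L = "b $ i - a $ i"
    have L: "?L > 0" using ab[of i] by simp
    have "cis (2 * pi / ?L * x $ i) = cis (2 * pi / ?L * y $ i)"
      using eq exhaust_2[of i] by (auto simp: torus_map_def)
    then have "sin (2 * pi / ?L * x $ i) = sin (2 * pi / ?L * y $ i) \<and>
        cos (2 * pi / ?L * x $ i) = cos (2 * pi / ?L * y $ i)"
      by (simp add: complex_eq_iff)
    then obtain n :: int where "2 * pi / ?L * x $ i = 2 * pi / ?L * y $ i + 2 * pi * n"
      using sin_cos_eq_iff by blast
    then have "2 * pi * (x $ i - y $ i) = 2 * pi * (n * ?L)"
      using L by (simp add: field_simps)
    then have n: "x $ i - y $ i = n * ?L" by simp
    have "\<bar>x $ i - y $ i\<bar> < ?L"
      using box assms(2,3) by (auto simp: mem_box_cart abs_less_iff) (smt (verit) )+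
    then have "\<bar>real_of_int n\<bar> * ?L < 1 * ?L" using L by (simp add: n abs_mult)
    then have "\<bar>real_of_int n\<bar> < 1" using L by (simp add: mult_less_cancel_right)
    then have "n = 0" by linarith
    then show ?thesis using n by simp
  qed
  then show "x = y" by (simp add: vec_eq_iff)
qed

text \<open>Stone-Weierstrass is applied on the image of the closed box under
  \<open>torus_map\<close>. As only boundary points are identified and h vanishes there, h descends
  to the image.\<close>

lemma trig_poly_uniform_approx:
  fixes h :: "real^2 \<Rightarrow> real"
  assumes ab: "\<And>j. a $ j < b $ j" and h: "continuous_on UNIV h"
    and h0: "\<And>x. x \<notin> box a b \<Longrightarrow> h x = 0" and "e > 0"
  shows "\<exists>\<tau> \<in> trig_poly (b - a) UNIV. \<forall>x\<in>cbox a b. \<bar>\<tau> x - h x\<bar> < e"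
proof -
  let ?E = "torus_map (b - a)"
  \<comment> \<open>Any preimage will do: \<open>HE\<close> shows that the value of h does not
    depend on it.\<close>
  define H where "H = (\<lambda>z. h (SOME x. x \<in> cbox a b \<and> ?E x = z))"
  have HE: "H (?E x) = h x" if "x \<in> cbox a b" for x
  proof -
    define y where "y = (SOME y. y \<in> cbox a b \<and> ?E y = ?E x)"
    have "y \<in> cbox a b \<and> ?E y = ?E x"
      unfolding y_def by (rule someI[where x = x]) (simp add: that)
    then have "y = x \<or> y \<notin> box a b \<and> x \<notin> box a b"
      using torus_map_eq_imp[OF ab] that by blast
    then have "h y = h x" using h0 by auto
    then show ?thesis by (simp add: H_def y_def)
  qed
  have E: "continuous_on A ?E" for A
    unfolding torus_map_def by (intro continuous_intros)
  have K: "compact (?E ` cbox a b)"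
    by (intro compact_continuous_image E compact_cbox)
  \<comment> \<open>\<open>H\<close> pulls a closed set back to the image of a compact set, so it is
    continuous although the chosen preimages may jump.\<close>
  have "continuous_on (?E ` cbox a b) H"
  proof (subst continuous_on_closed_vimage[OF compact_imp_closed[OF K]], intro allI impI)
    fix C :: "real set" assume "closed C"
    have "H -` C \<inter> ?E ` cbox a b = ?E ` (h -` C \<inter> cbox a b)"
      unfolding image_def vimage_def by (force simp: HE)
    moreover have "compact (h -` C \<inter> cbox a b)"
      using \<open>closed C\<close> h
      by (intro closed_Int_compact compact_cbox continuous_closed_vimage)
        (simp_all add: continuous_on_eq_continuous_within)
    ultimately show "closed (H -` C \<inter> ?E ` cbox a b)"
      using compact_imp_closed[OF compact_continuous_image[OF E]] by simp
  qed
  then obtain g where g: "polynomial_function g" "\<And>z. z \<in> ?E ` cbox a b \<Longrightarrow> norm (H z - g z) < e"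
    using Stone_Weierstrass_polynomial_function[OF K _ \<open>e > 0\<close>, of H] by blast
  show ?thesis
  proof (rule bexI[where x = "\<lambda>x. g (?E x)"])
    show "(\<lambda>x. g (?E x)) \<in> trig_poly (b - a) UNIV"
      using g(1) by (intro polynomial_torus_map) (simp add: real_polynomial_function_eq)
    show "\<forall>x\<in>cbox a b. \<bar>g (?E x) - h x\<bar> < e"
    proof
      fix x assume x: "x \<in> cbox a b"
      from g(2)[OF imageI[OF x]] show "\<bar>g (?E x) - h x\<bar> < e"
        by (simp add: HE[OF x] abs_minus_commute)
    qed
  qed
qed

text \<open>A measurable function is an almost everywhere limit of continuous ones. These are made
  uniformly bounded and zero outside the open box, then replaced by uniformly close trigonometric
  polynomials; dominated convergence gives the limit in \<open>L2\<close>.\<close>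

lemma trig_poly_L2_dense:
  assumes S: "admissible (Periodic a b)" and f: "f \<in> L2 (Periodic a b)"
    and bound: "AE x in lebS (Periodic a b). norm (f x) \<le> K"
  obtains \<tau> where "\<And>n::nat. \<tau> n \<in> trig_poly (b - a) UNIV"
    "(\<lambda>n. L2_norm (Periodic a b) (\<lambda>x. \<tau> n x - f x)) \<longlonglongrightarrow> 0"
proof -
  let ?M = "lebS (Periodic a b)"
  interpret finite_measure ?M by (rule finite_measure_lebS[OF S])
  have ab: "a $ j < b $ j" for j using S by simp
  have fm: "f \<in> borel_measurable (lebesgue_on (box a b))" using L2_measurable[OF f] by simp
  then have "(\<lambda>x. if x \<in> box a b then f x else 0) \<in> borel_measurable lebesgue"
    by (simp add: borel_measurable_if)
  then have "(\<lambda>x. if x \<in> box a b then f x else 0) measurable_on UNIV"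
    by (rule lebesgue_measurable_imp_measurable_on) simp
  then obtain N g where N: "negligible N" and g: "\<And>n::nat. continuous_on UNIV (g n)"
    and lim: "\<And>x. x \<notin> N \<Longrightarrow> (\<lambda>n. g n x) \<longlonglongrightarrow> (if x \<in> box a b then f x else 0)"
    by (auto simp: measurable_on_def)
  \<comment> \<open>Truncation at \<open>\<bar>K\<bar>\<close> gives a uniform bound; the second
    factor vanishes outside the open box and is eventually 1 at each of its points. The absolute
    value avoids a separate proof that K is nonnegative.\<close>
  define h where "h = (\<lambda>n x. max (- \<bar>K\<bar>) (min \<bar>K\<bar> (g n x)) * min 1 (real n * infdist x (- box a b)))"
  have h_cont: "continuous_on UNIV (h n)" for n
    unfolding h_def by (intro continuous_intros g)
  have h0: "h n x = 0" if "x \<notin> box a b" for n x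
    using that by (simp add: h_def infdist_zero)
  have h_bound: "\<bar>h n x\<bar> \<le> \<bar>K\<bar>" for n x
  proof -
    have "\<bar>max (- \<bar>K\<bar>) (min \<bar>K\<bar> (g n x))\<bar> \<le> \<bar>K\<bar>" by linarith
    moreover have "\<bar>min 1 (real n * infdist x (- box a b))\<bar> \<le> 1"
      using mult_nonneg_nonneg[OF of_nat_0_le_iff[of n] infdist_nonneg[of x "- box a b"]]
      by (simp add: abs_if)
    ultimately have "\<bar>h n x\<bar> \<le> \<bar>K\<bar> * 1"
      unfolding h_def abs_mult by (intro mult_mono) auto
    then show ?thesis by simp
  qed
  have "\<exists>\<tau> \<in> trig_poly (b - a) UNIV. \<forall>x\<in>cbox a b. \<bar>\<tau> x - h n x\<bar> < 1 / Suc n" for n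
    by (rule trig_poly_uniform_approx[OF ab h_cont h0]) auto
  then obtain \<tau> where \<tau>: "\<And>n. \<tau> n \<in> trig_poly (b - a) UNIV"
    and \<tau>_h: "\<And>n x. x \<in> cbox a b \<Longrightarrow> \<bar>\<tau> n x - h n x\<bar> < 1 / Suc n"
    by metis
  have "AE x in ?M. x \<notin> N"
  proof -
    have "AE x in lebesgue. x \<notin> N"
      using N by (simp add: negligible_iff_null_sets AE_not_in)
    then show ?thesis by (auto simp: AE_restrict_space_iff elim: eventually_mono)
  qed
  then have conv: "AE x in ?M. (\<lambda>n. \<tau> n x) \<longlonglongrightarrow> f x"
    using bound AE_space[of ?M]
  proof eventually_elim
    case (elim x)
    then have x: "x \<in> box a b" by simp
    have "(\<lambda>n. max (- \<bar>K\<bar>) (min \<bar>K\<bar> (g n x))) \<longlonglongrightarrow> max (- \<bar>K\<bar>) (min \<bar>K\<bar> (f x))"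
      using lim[of x] elim x by (intro tendsto_intros) auto
    moreover have "max (- \<bar>K\<bar>) (min \<bar>K\<bar> (f x)) = f x" using elim by auto
    moreover have "(\<lambda>n. min 1 (real n * infdist x (- box a b))) \<longlonglongrightarrow> 1"
    proof (rule tendsto_eventually)
      have "- box a b \<noteq> {}" using bounded_box[of a b] not_bounded_UNIV
        by (metis Compl_eq_Diff_UNIV Diff_eq_empty_iff top.extremum_unique)
      then have "infdist x (- box a b) > 0"
        using x infdist_pos_not_in_closed[of "- box a b" x] open_box[of a b] by (auto simp: closed_def)
      then have "filterlim (\<lambda>n. real n * infdist x (- box a b)) at_top sequentially"
        using filterlim_real_sequentially by (simp add: filterlim_tendsto_pos_mult_at_top[OF tendsto_const]
          mult.commute[of _ "infdist x (- box a b)"])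
      then have "\<forall>\<^sub>F n in sequentially. 1 \<le> real n * infdist x (- box a b)"
        by (simp add: filterlim_at_top)
      then show "\<forall>\<^sub>F n in sequentially. min 1 (real n * infdist x (- box a b)) = 1"
        by eventually_elim simp
    qed
    ultimately have h_lim: "(\<lambda>n. h n x) \<longlonglongrightarrow> f x"
      unfolding h_def using tendsto_mult[where a = "f x" and b = "1 :: real"] by simp
    have "(\<lambda>n. \<tau> n x - h n x) \<longlonglongrightarrow> 0"
    proof (rule Lim_null_comparison)
      show "\<forall>\<^sub>F n in sequentially. norm (\<tau> n x - h n x) \<le> 1 / Suc n"
        using \<tau>_h[of x] x box_subset_cbox[of a b] by (auto intro!: always_eventually less_imp_le)
      show "(\<lambda>n. 1 / real (Suc n)) \<longlonglongrightarrow> 0"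
        using LIMSEQ_inverse_real_of_nat by (simp add: inverse_eq_divide)
    qed
    from tendsto_add[OF this h_lim] show ?case by simp
  qed
  have \<tau>_L2: "(\<lambda>x. \<tau> n x - f x) \<in> L2 (Periodic a b)" for n
    by (intro L2_diff f trig_poly_L2[OF S \<tau>])
  have "(\<lambda>n. \<integral>x. (\<tau> n x - f x)\<^sup>2 \<partial>?M) \<longlonglongrightarrow> (\<integral>x. 0 \<partial>?M)"
  \<comment> \<open>\<open>\<tau> n\<close> is within 1 of \<open>h n\<close>, and both
    \<open>h n\<close> and f are bounded by \<open>\<bar>K\<bar>\<close>, whence the
    constant.\<close>
  proof (rule integral_dominated_convergence[where w = "\<lambda>x. (2 * \<bar>K\<bar> + 1)\<^sup>2"])
    show "(\<lambda>x. (\<tau> n x - f x)\<^sup>2) \<in> borel_measurable ?M" for n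
      using L2_measurable[OF \<tau>_L2] by simp
    show "AE x in ?M. (\<lambda>n. (\<tau> n x - f x)\<^sup>2) \<longlonglongrightarrow> 0"
      using conv
    proof eventually_elim
      case (elim x)
      from tendsto_power[OF tendsto_diff[OF elim tendsto_const[of "f x"]], of 2] show ?case by simp
    qed
    show "AE x in ?M. norm ((\<tau> n x - f x)\<^sup>2) \<le> (2 * \<bar>K\<bar> + 1)\<^sup>2" for n
      using bound AE_space[of ?M]
    proof eventually_elim
      case (elim x)
      then have "x \<in> cbox a b" using box_subset_cbox[of a b] by auto
      then have "\<bar>\<tau> n x - h n x\<bar> < 1 / Suc n" by (rule \<tau>_h)
      also have "\<dots> \<le> 1" by simp
      finally have "\<bar>\<tau> n x - f x\<bar> \<le> 2 * \<bar>K\<bar> + 1" using h_bound[of n x] elim by auto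
      then show ?case using power_mono[of "\<bar>\<tau> n x - f x\<bar>" "2 * \<bar>K\<bar> + 1" 2] by simp
    qed
    show "integrable ?M (\<lambda>x. (2 * \<bar>K\<bar> + 1)\<^sup>2)"
      by (rule integrable_const)
  qed simp
  from tendsto_real_sqrt[OF this]
  have "(\<lambda>n. L2_norm (Periodic a b) (\<lambda>x. \<tau> n x - f x)) \<longlonglongrightarrow> 0"
    by (simp add: L2_norm_def)
  with \<tau> show thesis by (rule that)
qed

section \<open>Consequences of density on the torus\<close>

lemma periodic_test_closure:
  assumes "admissible (Periodic a b)" "f \<in> L2 (Periodic a b)"
    and "AE x in lebS (Periodic a b). norm (f x) \<le> K"
  shows "f \<in> test_closure (Periodic a b)"
proof -
  obtain \<tau> where \<tau>: "\<And>n::nat. \<tau> n \<in> trig_poly (b - a) UNIV"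
    and lim: "(\<lambda>n. L2_norm (Periodic a b) (\<lambda>x. \<tau> n x - f x)) \<longlonglongrightarrow> 0"
    by (rule trig_poly_L2_dense[OF assms]) (rule that)
  have "\<forall>n. \<tau> n \<in> test_functions (Periodic a b)"
    using trig_poly_test_functions[OF assms(1) \<tau>] by (rule allI)
  then show ?thesis
    unfolding test_closure_def using assms(2) lim by (intro CollectI conjI exI[of _ \<tau>])
qed

text \<open>Only the second factors converge; the first are merely bounded in norm. The conclusion
  is therefore about a difference, as neither pairing has a known limit.\<close>

lemma tendsto_L2_inner_bounded_diff:
  assumes "\<And>n. \<phi> n \<in> L2 S" "\<And>n. \<tau> n \<in> L2 S" "f \<in> L2 S"
    and "\<And>n. L2_norm S (\<phi> n) \<le> C" "(\<lambda>n. L2_norm S (\<lambda>x. \<tau> n x - f x)) \<longlonglongrightarrow> 0"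
  shows "(\<lambda>n. L2_inner S (\<phi> n) (\<tau> n) - L2_inner S (\<phi> n) f) \<longlonglongrightarrow> 0"
proof (rule Lim_null_comparison)
  show "(\<lambda>n. C * L2_norm S (\<lambda>x. \<tau> n x - f x)) \<longlonglongrightarrow> 0"
    using tendsto_mult_left[OF assms(5), of C] by simp
  show "\<forall>\<^sub>F n in sequentially. norm (L2_inner S (\<phi> n) (\<tau> n) - L2_inner S (\<phi> n) f)
      \<le> C * L2_norm S (\<lambda>x. \<tau> n x - f x)"
  proof (intro always_eventually allI)
    fix n
    have "\<bar>L2_inner S (\<phi> n) (\<lambda>x. \<tau> n x - f x)\<bar> \<le> L2_norm S (\<phi> n) * L2_norm S (\<lambda>x. \<tau> n x - f x)"
      by (intro L2_inner_le_norm L2_diff assms)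
    also have "\<dots> \<le> C * L2_norm S (\<lambda>x. \<tau> n x - f x)"
      by (intro mult_right_mono assms L2_norm_nonneg)
    finally show "norm (L2_inner S (\<phi> n) (\<tau> n) - L2_inner S (\<phi> n) f) \<le> C * L2_norm S (\<lambda>x. \<tau> n x - f x)"
      by (simp add: L2_inner_diff_right assms)
  qed
qed

text \<open>The modes \<open>F n\<close> are chosen after the approximations \<open>\<rho> n\<close>
  of the divergence and \<open>\<sigma> i n\<close> of the components of v, and contain all
  frequencies used by them. Projecting w onto \<open>F n\<close> therefore preserves its pairing
  with \<open>\<rho> n\<close> and the pairings of its derivatives with \<open>\<sigma> i n\<close>,
  while the projection is smooth and periodic, as the weak divergence of v demands.\<close>

lemma periodic_integration_by_parts:
  assumes S: "admissible (Periodic a b)" and v: "v \<in> Hdiv (Periodic a b)"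
    and w: "w \<in> H1 (Periodic a b)"
    and K: "AE x in lebS (Periodic a b). norm (v x) \<le> K"
    and L: "AE x in lebS (Periodic a b). norm (wdiv (Periodic a b) v x) \<le> L"
  shows "L2_inner (Periodic a b) (grad (Periodic a b) w) v
    = - L2_inner (Periodic a b) w (wdiv (Periodic a b) v)"
proof -
  let ?S = "Periodic a b"
  let ?g = "\<lambda>i x. grad ?S w x $ i" and ?v = "\<lambda>i x. v x $ i" and ?d = "wdiv ?S v"
  note vL = Hdiv_wdiv[OF v] and wL = H1_grad[OF w]
  obtain \<rho> where \<rho>: "\<And>n::nat. \<rho> n \<in> trig_poly (b - a) UNIV"
    "(\<lambda>n. L2_norm ?S (\<lambda>x. \<rho> n x - ?d x)) \<longlonglongrightarrow> 0"
    using trig_poly_L2_dense[OF S vL(3) L] by blast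
  have "\<exists>\<sigma>. (\<forall>n::nat. \<sigma> n \<in> trig_poly (b - a) UNIV) \<and>
      (\<lambda>n. L2_norm ?S (\<lambda>x. \<sigma> n x - ?v i x)) \<longlonglongrightarrow> 0" for i
  proof -
    have "AE x in lebS ?S. norm (?v i x) \<le> K"
      using K by eventually_elim (use component_le_norm_cart order_trans in fastforce)
    then show ?thesis
      by (rule trig_poly_L2_dense[OF S L2_component[OF vL(1)]]) blast
  qed
  then have "\<exists>\<sigma>. \<forall>i. (\<forall>n::nat. \<sigma> i n \<in> trig_poly (b - a) UNIV) \<and>
      (\<lambda>n. L2_norm ?S (\<lambda>x. \<sigma> i n x - ?v i x)) \<longlonglongrightarrow> 0"
    by (intro choice) blast
  then obtain \<sigma> where \<sigma>: "\<And>i n. \<sigma> i (n::nat) \<in> trig_poly (b - a) UNIV"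
    "\<And>i. (\<lambda>n. L2_norm ?S (\<lambda>x. \<sigma> i n x - ?v i x)) \<longlonglongrightarrow> 0"
    by blast
  have "\<exists>F. finite F \<and> F \<noteq> {} \<and> \<rho> n \<in> trig_poly (b - a) F \<and> (\<forall>i. \<sigma> i n \<in> trig_poly (b - a) F)" for n
  proof -
    obtain F where F: "finite F" "\<rho> n \<in> trig_poly (b - a) F"
      using trig_poly_finite_modes[OF \<rho>(1)] by blast
    have "\<exists>G. \<forall>i. finite (G i) \<and> \<sigma> i n \<in> trig_poly (b - a) (G i)"
      by (intro choice allI trig_poly_finite_modes \<sigma>(1))
    then obtain G where G: "\<And>i. finite (G i) \<and> \<sigma> i n \<in> trig_poly (b - a) (G i)" by blast
    show ?thesis
    \<comment> \<open>Inserting the zero frequency makes it immediate that the set of modes is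
      nonempty.\<close>
    proof (intro exI[of _ "insert (\<lambda>_. 0) (F \<union> (\<Union>i. G i))"] conjI allI)
      show "\<rho> n \<in> trig_poly (b - a) (insert (\<lambda>_. 0) (F \<union> (\<Union>i. G i)))"
        using F by (blast intro: trig_poly_mono)
      show "\<sigma> i n \<in> trig_poly (b - a) (insert (\<lambda>_. 0) (F \<union> (\<Union>i. G i)))" for i
        by (rule trig_poly_mono[OF G[THEN conjunct2, of i]]) blast
    qed (use F G in auto)
  qed
  then have "\<exists>F. \<forall>n. finite (F n) \<and> F n \<noteq> {} \<and> \<rho> n \<in> trig_poly (b - a) (F n) \<and>
      (\<forall>i. \<sigma> i n \<in> trig_poly (b - a) (F n))"
    by (intro choice) blast
  then obtain F where F: "\<And>n. finite (F n)" "\<And>n. F n \<noteq> {}"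
    "\<And>n. \<rho> n \<in> trig_poly (b - a) (F n)" "\<And>i n. \<sigma> i n \<in> trig_poly (b - a) (F n)"
    by blast
  define good where "good n \<phi> \<longleftrightarrow> \<phi> \<in> trig_poly (b - a) (F n) \<and> L2_norm ?S \<phi> \<le> L2_norm ?S w \<and>
      L2_inner ?S \<phi> (\<rho> n) = L2_inner ?S w (\<rho> n) \<and>
      (\<forall>i. L2_norm ?S (partial i \<phi>) \<le> L2_norm ?S (?g i)) \<and>
      (\<forall>i. L2_inner ?S (partial i \<phi>) (\<sigma> i n) = L2_inner ?S (?g i) (\<sigma> i n))" for n \<phi>
  have "\<exists>\<phi>. good n \<phi>" for n
    unfolding good_def by (rule trig_poly_projection[OF S w F(1,2)[of n]]) (use F(3,4) in blast)
  then obtain \<phi> where good: "\<And>n. good n (\<phi> n)" by metis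
  have \<phi>: "\<phi> n \<in> trig_poly (b - a) (F n)"
    and \<phi>_norm: "L2_norm ?S (\<phi> n) \<le> L2_norm ?S w"
      "L2_norm ?S (partial i (\<phi> n)) \<le> L2_norm ?S (?g i)"
    and \<phi>_inner: "L2_inner ?S (\<phi> n) (\<rho> n) = L2_inner ?S w (\<rho> n)"
      "L2_inner ?S (partial i (\<phi> n)) (\<sigma> i n) = L2_inner ?S (?g i) (\<sigma> i n)" for n i
    using good[of n] by (simp_all add: good_def)
  note tL2 = trig_poly_L2[OF S]
  have weak: "L2_inner ?S (\<phi> n) ?d + (\<Sum>i\<in>UNIV. L2_inner ?S (partial i (\<phi> n)) (?v i)) = 0" for n
  proof -
    have t: "\<phi> n \<in> test_functions ?S" by (rule trig_poly_test_functions[OF S \<phi>])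
    have "L2_inner ?S v (classical_grad (\<phi> n)) = (\<Sum>i\<in>UNIV. L2_inner ?S (?v i) (partial i (\<phi> n)))"
      by (simp add: L2_inner_components[OF vL(1) classical_grad_L2[OF S t]] classical_grad_def)
    moreover have "L2_inner ?S v (classical_grad (\<phi> n)) = - L2_inner ?S ?d (\<phi> n)"
      using vL(2) t by (simp add: is_weak_div_iff)
    ultimately show ?thesis
      by (simp add: L2_inner_commute[of _ "\<phi> n"] L2_inner_commute[of _ "partial _ (\<phi> n)"])
  qed
  \<comment> \<open>In the vanishing differences below, the terms with \<open>?d\<close> and
    \<open>?v\<close> cancel by \<open>weak\<close>, and the pairings of \<phi> and its derivatives
    become those of w and its gradient. What remains is \<open>?X\<close>, which tends both to zero
    and to the sum of the two sides to be compared.\<close>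
  let ?X = "\<lambda>n. L2_inner ?S w (\<rho> n) + (\<Sum>i\<in>UNIV. L2_inner ?S (?g i) (\<sigma> i n))"
  have "(\<lambda>n. (L2_inner ?S (\<phi> n) (\<rho> n) - L2_inner ?S (\<phi> n) ?d)
      + (\<Sum>i\<in>UNIV. L2_inner ?S (partial i (\<phi> n)) (\<sigma> i n) - L2_inner ?S (partial i (\<phi> n)) (?v i)))
      \<longlonglongrightarrow> 0 + (\<Sum>i\<in>(UNIV :: 2 set). 0)"
    by (intro tendsto_add tendsto_sum tendsto_L2_inner_bounded_diff[OF tL2 tL2 _ _ \<rho>(2)]
        tendsto_L2_inner_bounded_diff[OF tL2 tL2 _ _ \<sigma>(2)])
      (rule \<phi> \<phi>_norm F vL L2_component trig_poly_partial | assumption)+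
  moreover have "(L2_inner ?S (\<phi> n) (\<rho> n) - L2_inner ?S (\<phi> n) ?d)
      + (\<Sum>i\<in>UNIV. L2_inner ?S (partial i (\<phi> n)) (\<sigma> i n) - L2_inner ?S (partial i (\<phi> n)) (?v i)) = ?X n" for n
    using weak[of n] by (simp add: \<phi>_inner sum_subtractf)
  ultimately have "?X \<longlonglongrightarrow> 0" by simp
  moreover have "?X \<longlonglongrightarrow> L2_inner ?S w ?d + (\<Sum>i\<in>UNIV. L2_inner ?S (?g i) (?v i))"
    by (intro tendsto_add tendsto_sum tendsto_L2_inner tL2[OF \<rho>(1)] tL2[OF \<sigma>(1)] \<rho>(2) \<sigma>(2)
        L2_component vL wL)
  ultimately have "L2_inner ?S w ?d + (\<Sum>i\<in>UNIV. L2_inner ?S (?g i) (?v i)) = 0"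
    using LIMSEQ_unique by blast
  then show ?thesis by (simp add: L2_inner_components[OF wL(3) vL(1)])
qed


section \<open>Discrete operators\<close>

lemma fe_space_subspace: "fe_space S V Vh \<Longrightarrow> fun_subspace Vh"
  by (simp add: fe_space_def fun_subspace_def)

lemma fe_space_bounded:
  assumes "fe_space S V Vh" "f \<in> Vh" obtains K where "AE x in lebS S. norm (f x) \<le> K"
  using assms by (auto simp: fe_space_def)

lemma V1_L2: "V1 S \<subseteq> L2 S"
  using V1_Hdiv Hdiv_wdiv(1) by blast

lemma fe_space_riesz:
  assumes Vh: "fe_space S V Vh" and "V \<subseteq> L2 S" and l: "linear_functional_on Vh l"
    and l_null: "\<And>f. f \<in> Vh \<Longrightarrow> AE x in lebS S. f x = 0 \<Longrightarrow> l f = 0"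
  shows "\<exists>g. g \<in> Vh \<and> (\<forall>f\<in>Vh. L2_inner S g f = l f)"
proof -
  obtain B where "finite B" "B \<subseteq> Vh"
    and "\<forall>f\<in>Vh. \<exists>c. AE x in lebS S. f x = (\<Sum>b\<in>B. c b *\<^sub>R b x)"
    using Vh by (auto simp: fe_space_def)
  moreover have "Vh \<subseteq> L2 S" using assms(1,2) by (auto simp: fe_space_def)
  ultimately show ?thesis
    by (intro riesz_finite_dim[where B = B] fe_space_subspace[OF Vh] l l_null) auto
qed

text \<open>Justifies the choice in the definition of \<open>L2_proj\<close>: the pairing with f is
  a functional to which Riesz applies.\<close>

lemma L2_proj:
  assumes Vh: "fe_space S V Vh" and V: "V \<subseteq> L2 S" and f: "f \<in> L2 S"
  shows "L2_proj S Vh f \<in> Vh"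
    and "h \<in> Vh \<Longrightarrow> L2_inner S (L2_proj S Vh f) h = L2_inner S f h"
proof -
  have sub: "Vh \<subseteq> L2 S" using Vh V by (auto simp: fe_space_def)
  have "L2_inner S f h = 0" if "h \<in> Vh" "AE x in lebS S. h x = 0" for h
    using L2_inner_cong_AE_right[OF subsetD[OF sub that(1)] L2_zero f] that(2)
    by (simp add: L2_inner_def)
  then have "\<exists>g. g \<in> Vh \<and> (\<forall>h\<in>Vh. L2_inner S g h = L2_inner S f h)"
    by (intro fe_space_riesz[OF Vh V] linear_functional_L2_inner[OF sub f])
  from someI_ex[OF this] show "L2_proj S Vh f \<in> Vh"
    and "h \<in> Vh \<Longrightarrow> L2_inner S (L2_proj S Vh f) h = L2_inner S f h"
    by (auto simp: L2_proj_def)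
qed

text \<open>On the torus, membership of the divergence in \<open>V2h\<close> supplies the essential
  bound on which the approximation relies; with homogeneous boundary conditions the property is
  built into \<open>Hdiv_0\<close>.\<close>

lemma fe_wdiv_test_closure:
  assumes S: "admissible S" and V1h: "fe_space S (V1 S) V1h" and V2h: "fe_space S (V2 S) V2h"
    and "wdiv S ` V1h \<subseteq> V2h" and v: "v \<in> V1h"
  shows "wdiv S v \<in> test_closure S"
proof (cases S)
  case (Periodic a b)
  have "wdiv S v \<in> V2h" using assms by auto
  then obtain K where "AE x in lebS S. norm (wdiv S v x) \<le> K"
    using fe_space_bounded[OF V2h] by blast
  moreover have "wdiv S v \<in> L2 S" using \<open>wdiv S v \<in> V2h\<close> V2h by (auto simp: fe_space_def V2_def)
  ultimately show ?thesis using periodic_test_closure S Periodic by blast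
next
  case (Homogeneous \<Omega>)
  then have "v \<in> Hdiv_0 S" using V1h v by (auto simp: fe_space_def)
  then show ?thesis by (rule Hdiv_0_wdiv_test_closure[OF S])
qed

lemma fe_integration_by_parts:
  assumes S: "admissible S" and V1h: "fe_space S (V1 S) V1h" and V2h: "fe_space S (V2 S) V2h"
    and "wdiv S ` V1h \<subseteq> V2h" and v: "v \<in> V1h" and w: "w \<in> H1 S"
  shows "L2_inner S (grad S w) v = - L2_inner S w (wdiv S v)"
proof (cases S)
  case (Periodic a b)
  have "wdiv S v \<in> V2h" using assms by auto
  then obtain L where L: "AE x in lebS S. norm (wdiv S v x) \<le> L"
    using fe_space_bounded[OF V2h] by blast
  obtain K where K: "AE x in lebS S. norm (v x) \<le> K"
    using fe_space_bounded[OF V1h v] by blast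
  have "v \<in> Hdiv S" using V1h v V1_Hdiv by (auto simp: fe_space_def)
  then show ?thesis using periodic_integration_by_parts S w K L Periodic by blast
next
  case (Homogeneous \<Omega>)
  then have "v \<in> Hdiv_0 S" using V1h v by (auto simp: fe_space_def)
  then show ?thesis by (rule Hdiv_0_integration_by_parts[OF S _ w])
qed

text \<open>The functional to be represented pairs q with \<open>wdiv S v\<close>. As
  \<open>wdiv\<close> is an arbitrary choice of weak divergence, its linearity and its vanishing on
  null functions are derived from uniqueness inside \<open>test_closure\<close>.\<close>

lemma dual_grad:
  assumes S: "admissible S" and V1h: "fe_space S (V1 S) V1h" and V2h: "fe_space S (V2 S) V2h"
    and div: "wdiv S ` V1h \<subseteq> V2h" and q: "q \<in> V2h"
  shows "dual_grad S V1h q \<in> V1h"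
    and "v \<in> V1h \<Longrightarrow> L2_inner S (dual_grad S V1h q) v = - L2_inner S q (wdiv S v)"
proof -
  note closure = fe_wdiv_test_closure[OF S V1h V2h div]
  have L2: "q \<in> L2 S" using q V2h by (auto simp: fe_space_def V2_def)
  have Hdiv: "v \<in> Hdiv S" if "v \<in> V1h" for v using V1h that V1_Hdiv by (auto simp: fe_space_def)
  note sub = fun_subspaceD[OF fe_space_subspace[OF V1h]]
  note v_L2 = Hdiv_wdiv(1)[OF Hdiv] and div_L2 = Hdiv_wdiv(3)[OF Hdiv]
  \<comment> \<open>Any weak divergence d in the closure of the test functions may replace the
    chosen one; below, d is a sum, a multiple or zero.\<close>
  have unique: "L2_inner S q (wdiv S v) = L2_inner S q d"
    if "v \<in> V1h" "is_weak_div S v d" "d \<in> test_closure S" for v d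
  proof -
    have "AE x in lebS S. wdiv S v x = d x"
      using Hdiv_wdiv(2)[OF Hdiv[OF that(1)]] that(2)
      by (intro test_closure_unique[OF S closure[OF that(1)] that(3)]) (auto simp: is_weak_div_iff)
    then show ?thesis
      using that L2 div_L2 by (intro L2_inner_cong_AE_right) (auto simp: test_closure_def)
  qed
  have lin: "linear_functional_on V1h (\<lambda>v. - L2_inner S q (wdiv S v))"
    unfolding linear_functional_on_def
  proof (intro conjI ballI allI)
    fix u v assume uv: "u \<in> V1h" "v \<in> V1h"
    have "L2_inner S q (wdiv S (\<lambda>x. u x + v x)) = L2_inner S q (\<lambda>x. wdiv S u x + wdiv S v x)"
      using uv by (intro unique sub is_weak_div_add test_closure_add S closure v_L2 Hdiv_wdiv(2) Hdiv)
    then show "- L2_inner S q (wdiv S (\<lambda>x. u x + v x))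
        = - L2_inner S q (wdiv S u) + - L2_inner S q (wdiv S v)"
      using uv by (simp add: L2_inner_add_right L2 div_L2)
  next
    fix c u assume u: "u \<in> V1h"
    have "L2_inner S q (wdiv S (\<lambda>x. c *\<^sub>R u x)) = L2_inner S q (\<lambda>x. c * wdiv S u x)"
      using u by (intro unique sub is_weak_div_scale test_closure_scale closure Hdiv_wdiv(2) Hdiv)
    then show "- L2_inner S q (wdiv S (\<lambda>x. c *\<^sub>R u x)) = c * - L2_inner S q (wdiv S u)"
      using L2_inner_scale_right[of S q c "wdiv S u"] by simp
  qed
  have null: "- L2_inner S q (wdiv S v) = 0" if v: "v \<in> V1h" "AE x in lebS S. v x = 0" for v
  proof -
    have "L2_inner S v (classical_grad \<phi>) = 0" if "\<phi> \<in> test_functions S" for \<phi>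
      using L2_inner_cong_AE_right[OF v_L2[OF v(1)] L2_zero classical_grad_L2[OF S that] v(2)]
      by (subst L2_inner_commute) (simp add: L2_inner_def)
    then have "is_weak_div S v (\<lambda>x. 0)"
      by (simp add: is_weak_div_iff L2_zero) (simp add: L2_inner_def)
    moreover have "(\<lambda>x. 0) \<in> test_closure S"
      using test_closure_scale[OF closure[OF v(1)], of 0] by simp
    ultimately show ?thesis using unique[OF v(1)] by (simp add: L2_inner_def)
  qed
  have "\<exists>g. g \<in> V1h \<and> (\<forall>v\<in>V1h. L2_inner S g v = - L2_inner S q (wdiv S v))"
    by (rule fe_space_riesz[OF V1h V1_L2 lin null])
  from someI_ex[OF this] show "dual_grad S V1h q \<in> V1h"
    and "v \<in> V1h \<Longrightarrow> L2_inner S (dual_grad S V1h q) v = - L2_inner S q (wdiv S v)"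
    by (auto simp: dual_grad_def)
qed

theorem proposition7:
  fixes S :: flow_domain
    and V0h V2h :: "(real^2 \<Rightarrow> real) set" and V1h :: "(real^2 \<Rightarrow> real^2) set"
    and \<nu> T :: real
    and f :: "real \<Rightarrow> real^2 \<Rightarrow> real^2" and \<psi> :: "real \<Rightarrow> real^2 \<Rightarrow> real"
    and u :: "real \<Rightarrow> real^2 \<Rightarrow> real^2" and p :: "real \<Rightarrow> real^2 \<Rightarrow> real"
  assumes "admissible S"
    and "discrete_complex S V0h V1h V2h"
    and "\<nu> \<ge> 0" and "T > 0"
    and "\<And>t. t \<in> {0..T} \<Longrightarrow> f t \<in> L2 S"
    and "\<And>t. t \<in> {0..T} \<Longrightarrow> \<psi> t \<in> H1 S"
  shows "solves S V0h V1h V2h \<nu> T f u p \<longleftrightarrow>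
         solves S V0h V1h V2h \<nu> T (\<lambda>t x. f t x + grad S (\<psi> t) x)
           u (\<lambda>t x. p t x + L2_proj S V2h (\<psi> t) x)"
proof -
  have V1h: "fe_space S (V1 S) V1h" and V2h: "fe_space S (V2 S) V2h"
    and div: "wdiv S ` V1h \<subseteq> V2h"
    using assms(2) by (auto simp: discrete_complex_def)
  have V1h_L2: "V1h \<subseteq> L2 S" using V1h V1_L2 by (auto simp: fe_space_def)
  have V2h_L2: "V2h \<subseteq> L2 S" using V2h by (auto simp: fe_space_def V2_def)
  note sub2 = fun_subspaceD[OF fe_space_subspace[OF V2h]]
  note dual = dual_grad[OF assms(1) V1h V2h div]
  note H1 = H1_grad[OF assms(6)]
  let ?P = "\<lambda>t. L2_proj S V2h (\<psi> t)"
  have P: "?P t \<in> V2h" "h \<in> V2h \<Longrightarrow> L2_inner S (?P t) h = L2_inner S (\<psi> t) h" if "t \<in> {0..T}" for t h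
    using L2_proj[OF V2h _ H1(1)[OF that]] by (auto simp: V2_def)
  \<comment> \<open>Membership of the pressure in \<open>V2h\<close> is part of
    \<open>solves\<close>, so it must transfer both ways; subtracting the projection gives the
    converse.\<close>
  have p_iff: "p t \<in> V2h \<longleftrightarrow> (\<lambda>x. p t x + ?P t x) \<in> V2h" if "t \<in> {0..T}" for t
  proof
    assume "(\<lambda>x. p t x + ?P t x) \<in> V2h"
    from sub2(2)[OF this sub2(3)[OF P(1)[OF that], of "-1"]] show "p t \<in> V2h" by simp
  qed (use sub2(2) P(1)[OF that] in auto)
  have rhs: "L2_inner S (\<lambda>x. f t x + grad S (\<psi> t) x) v
      = L2_inner S (f t) v + L2_inner S (grad S (\<psi> t)) v" if "t \<in> {0..T}" "v \<in> V1h" for t v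
    using that V1h_L2 by (intro L2_inner_add_left assms H1) auto
  \<comment> \<open>Only pairings with discrete velocities are compared: \<open>dual_grad\<close> is
    determined up to null sets, so its additivity is not an equation between functions.\<close>
  have lhs: "L2_inner S (dual_grad S V1h (\<lambda>x. p t x + ?P t x)) v
      = L2_inner S (dual_grad S V1h (p t)) v + L2_inner S (grad S (\<psi> t)) v"
    if t: "t \<in> {0..T}" and v: "v \<in> V1h" and p: "p t \<in> V2h" for t v
  proof -
    have d: "wdiv S v \<in> V2h" using div v by auto
    have "L2_inner S (dual_grad S V1h (\<lambda>x. p t x + ?P t x)) v
        = - L2_inner S (\<lambda>x. p t x + ?P t x) (wdiv S v)"
      using p_iff[OF t] p v by (intro dual) auto
    also have "\<dots> = - L2_inner S (p t) (wdiv S v) - L2_inner S (\<psi> t) (wdiv S v)"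
      using p P(1)[OF t] d V2h_L2 P(2)[OF t d] by (subst L2_inner_add_left) auto
    also have "\<dots> = L2_inner S (dual_grad S V1h (p t)) v + L2_inner S (grad S (\<psi> t)) v"
      using dual(2)[OF p v] fe_integration_by_parts[OF assms(1) V1h V2h div v assms(6)[OF t]] by simp
    finally show ?thesis .
  qed
  have pt: "p t \<in> V2h" if "(\<forall>t\<in>{0..T}. u t \<in> V1h \<and> p t \<in> V2h)" "t \<in> {0..T}" for t
    using that by auto
  \<comment> \<open>The velocity and its time derivative are the same on both sides, so the
    equivalence reduces, under the quantifiers, to that of single equations. In the pressure
    equation \<open>dual(1)\<close> makes the discrete gradient of q a legitimate v in
    \<open>lhs\<close> and \<open>rhs\<close>.\<close>
  show ?thesis
    unfolding solves_def
    by (intro conj_cong ex_cong1 ball_cong refl)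
      (use p_iff pt lhs rhs dual(1) in \<open>auto\<close>)
qed

end
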